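(* Let $H=\sum_{Z} h^Z$ be a local bounded Hamiltonian on a finite $D$-dimensional lattice $\Lambda$, let $\beta>0$, and suppose $(H,\beta)$ is uniformly $\epsilon(\ell)$-clustering. Let $X\subseteq\Lambda$ be partitioned into disjoint sets $X=A\cup B\cup C$ such that $B$ shields $A$ from $C$ in $X$ by a distance at least $\ell$, i.e. $\mathrm{dist}(A,C)\ge \ell$ and every path in $X$ from $A$ to $C$ passes through $B$. Let $\rho^X$ be the Gibbs state of $H^X$ and $\rho^{AB}$ the Gibbs state of $H^{AB}$. Then $$\big\|\mathrm{tr}_{BC}(\rho^X)-\mathrm{tr}_{B}(\rho^{AB})\big\|_1\le K\,|\partial C|\,\big(\epsilon(\ell/2)+\gamma(\ell/2)\big),$$ where $K$ is a constant independent of $\ell$ and of the regions, $\partial C$ is the set of sites of $C$ neighbouring $B$, and $\gamma$ is the belief-propagation error function of the model.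
   Context: Spins with finite-dimensional local Hilbert spaces sit on the sites of a finite square lattice $\Lambda\subseteq\mathbb{Z}^D$; $\mathrm{dist}$ is Euclidean distance, extended to sets by minimum. A local bounded Hamiltonian is $H=\sum_{Z\subset\Lambda}h^Z$ with each $h^Z$ bounded (uniformly) and supported on a constant number of adjacent sites. For $Y\subseteq\Lambda$, $H^Y=\sum_{Z\subseteq Y}h^Z$ (terms fully supported in $Y$) and $\rho^Y=e^{-\beta H^Y}/\mathrm{tr}\,e^{-\beta H^Y}$ is the Gibbs state on $Y$ (not the reduction of the global Gibbs state). Subscripts denote partial traces. The covariance is $\mathrm{Cov}_\sigma(f,g)=|\mathrm{tr}(\sigma fg)-\mathrm{tr}(\sigma f)\mathrm{tr}(\sigma g)|$. $(H,\beta)$ is uniformly $\epsilon(\ell)$-clustering if for every $X\subseteq\Lambda$ and all $A,B\subseteq X$ with $\mathrm{dist}(A,B)\ge\ell$, and all observables $f$ supported on $A$ and $g$ on $B$, $\mathrm{Cov}_{\rho^X}(f,g)\le\|f\|\,\|g\|\,\epsilon(\ell)$. Belief propagation error (standing assumption, from quantum belief propagation): there are constants $c_1,c_2$ and $\gamma(\ell)=c_1e^{-c_2\ell}$ such that whenever two Gibbs states $\rho^{Y}$, $\rho^{Y'}$ with $Y'=Y\setminus\{y\}$ differ by the constant number of Hamiltonian terms touching a single site $y$, there is an operator $\eta_\ell$ supported on the ball of radius $\ell$ around $y$, with $\|\eta_\ell^\dagger\eta_\ell\|$ bounded by a constant independent of $\ell$, such that $\|\rho^{Y'}-\eta_\ell\rho^{Y}\eta_\ell^\dagger\|_1\le\gamma(\ell)$.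 *)

theory Defs
  imports "HOL-Analysis.Analysis"
begin

(* Sites of the lattice Z^D (D = CARD('d)); a configuration assigns to each site a
   basis index; operators on a region Y are complex matrices indexed by the
   configurations of Y (the tensor product basis). *)
type_synonym 'd site = "int ^ 'd"
type_synonym 'd cfg = "'d site \<Rightarrow> nat"
type_synonym 'd op = "'d cfg \<Rightarrow> 'd cfg \<Rightarrow> complex"

definition ldist :: "'d::finite site \<Rightarrow> 'd site \<Rightarrow> real" where
  "ldist x y = dist ((\<chi> i. real_of_int (x $ i)) :: real ^ 'd) (\<chi> i. real_of_int (y $ i))"

(* basis of the Hilbert space of region Y; d x = local dimension at site x *)
definition cfgs :: "('d site \<Rightarrow> nat) \<Rightarrow> 'd site set \<Rightarrow> 'd cfg set" where
  "cfgs d Y = PiE Y (\<lambda>x. {..<d x})"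

definition mmult :: "('d site \<Rightarrow> nat) \<Rightarrow> 'd site set \<Rightarrow> 'd op \<Rightarrow> 'd op \<Rightarrow> 'd op" where
  "mmult d Y M N = (\<lambda>s t. \<Sum>u\<in>cfgs d Y. M s u * N u t)"

definition mone :: "'d op" where
  "mone = (\<lambda>s t. if s = t then 1 else 0)"

fun mpow :: "('d site \<Rightarrow> nat) \<Rightarrow> 'd site set \<Rightarrow> 'd op \<Rightarrow> nat \<Rightarrow> 'd op" where
  "mpow d Y M 0 = mone"
| "mpow d Y M (Suc n) = mmult d Y M (mpow d Y M n)"

definition mexp :: "('d site \<Rightarrow> nat) \<Rightarrow> 'd site set \<Rightarrow> 'd op \<Rightarrow> 'd op" where
  "mexp d Y M = (\<lambda>s t. \<Sum>n. mpow d Y M n s t / of_nat (fact n))"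

definition mtr :: "('d site \<Rightarrow> nat) \<Rightarrow> 'd site set \<Rightarrow> 'd op \<Rightarrow> complex" where
  "mtr d Y M = (\<Sum>s\<in>cfgs d Y. M s s)"

definition madj :: "'d op \<Rightarrow> 'd op" where
  "madj M = (\<lambda>s t. cnj (M t s))"

definition hermitian :: "('d site \<Rightarrow> nat) \<Rightarrow> 'd site set \<Rightarrow> 'd op \<Rightarrow> bool" where
  "hermitian d Y M \<longleftrightarrow> (\<forall>s\<in>cfgs d Y. \<forall>t\<in>cfgs d Y. M s t = cnj (M t s))"

definition opnorm :: "('d site \<Rightarrow> nat) \<Rightarrow> 'd site set \<Rightarrow> 'd op \<Rightarrow> real" where
  "opnorm d Y M = Sup {sqrt (\<Sum>s\<in>cfgs d Y. (cmod (\<Sum>t\<in>cfgs d Y. M s t * v t))\<^sup>2) | v.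
        (\<Sum>t\<in>cfgs d Y. (cmod (v t))\<^sup>2) = 1}"

definition psd :: "('d site \<Rightarrow> nat) \<Rightarrow> 'd site set \<Rightarrow> 'd op \<Rightarrow> bool" where
  "psd d Y R \<longleftrightarrow> hermitian d Y R \<and>
     (\<forall>v. 0 \<le> Re (\<Sum>s\<in>cfgs d Y. \<Sum>t\<in>cfgs d Y. cnj (v s) * R s t * v t))"

definition tnorm :: "('d site \<Rightarrow> nat) \<Rightarrow> 'd site set \<Rightarrow> 'd op \<Rightarrow> real" where
  "tnorm d Y M = Re (mtr d Y (THE R. psd d Y R
      \<and> (\<forall>s t. s \<notin> cfgs d Y \<or> t \<notin> cfgs d Y \<longrightarrow> R s t = 0)
      \<and> (\<forall>s\<in>cfgs d Y. \<forall>t\<in>cfgs d Y. mmult d Y R R s t = mmult d Y (madj M) M s t)))"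

definition ext_op :: "'d site set \<Rightarrow> 'd site set \<Rightarrow> 'd op \<Rightarrow> 'd op" where
  "ext_op Z Y M = (\<lambda>s t. if restrict s (Y - Z) = restrict t (Y - Z)
                          then M (restrict s Z) (restrict t Z) else 0)"

definition merge :: "'d site set \<Rightarrow> 'd cfg \<Rightarrow> 'd cfg \<Rightarrow> 'd cfg" where
  "merge W u s = (\<lambda>x. if x \<in> W then u x else s x)"

definition ptr :: "('d site \<Rightarrow> nat) \<Rightarrow> 'd site set \<Rightarrow> 'd op \<Rightarrow> 'd op" where
  "ptr d W M = (\<lambda>s t. \<Sum>u\<in>cfgs d W. M (merge W u s) (merge W u t))"

definition msub :: "'d op \<Rightarrow> 'd op \<Rightarrow> 'd op" where
  "msub M N = (\<lambda>s t. M s t - N s t)"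

definition ham :: "('d site \<Rightarrow> nat) \<Rightarrow> ('d site set \<Rightarrow> 'd op) \<Rightarrow> 'd site set \<Rightarrow> 'd op" where
  "ham d h Y = (\<lambda>s t. \<Sum>Z\<in>Pow Y. ext_op Z Y (h Z) s t)"

definition gibbs :: "('d site \<Rightarrow> nat) \<Rightarrow> ('d site set \<Rightarrow> 'd op) \<Rightarrow> real \<Rightarrow> 'd site set \<Rightarrow> 'd op" where
  "gibbs d h \<beta> Y = (let E = mexp d Y (\<lambda>s t. - of_real \<beta> * ham d h Y s t)
                     in (\<lambda>s t. E s t / mtr d Y E))"

definition cov :: "('d site \<Rightarrow> nat) \<Rightarrow> 'd site set \<Rightarrow> 'd op \<Rightarrow> 'd op \<Rightarrow> 'd op \<Rightarrow> real" where
  "cov d X \<sigma> f g = cmod (mtr d X (mmult d X \<sigma> (mmult d X f g))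
                         - mtr d X (mmult d X \<sigma> f) * mtr d X (mmult d X \<sigma> g))"

definition is_path :: "'d::finite site set \<Rightarrow> 'd site list \<Rightarrow> bool" where
  "is_path S p \<longleftrightarrow> p \<noteq> [] \<and> set p \<subseteq> S \<and>
     (\<forall>i. Suc i < length p \<longrightarrow> ldist (p ! i) (p ! Suc i) = 1)"

definition lconnected :: "'d::finite site set \<Rightarrow> bool" where
  "lconnected Z \<longleftrightarrow> (\<forall>x\<in>Z. \<forall>y\<in>Z. \<exists>p. is_path Z p \<and> hd p = x \<and> last p = y)"

definition local_bounded_ham ::
  "('d::finite site \<Rightarrow> nat) \<Rightarrow> ('d site set \<Rightarrow> 'd op) \<Rightarrow> nat \<Rightarrow> real \<Rightarrow> bool" where
  "local_bounded_ham d h r J \<longleftrightarrow> (\<forall>Z. finite Z \<longrightarrow>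
     hermitian d Z (h Z) \<and> opnorm d Z (h Z) \<le> J \<and>
     ((\<exists>s\<in>cfgs d Z. \<exists>t\<in>cfgs d Z. h Z s t \<noteq> 0) \<longrightarrow> card Z \<le> r \<and> lconnected Z))"

definition uniformly_clustering ::
  "('d::finite site \<Rightarrow> nat) \<Rightarrow> ('d site set \<Rightarrow> 'd op) \<Rightarrow> real \<Rightarrow> 'd site set \<Rightarrow> (real \<Rightarrow> real) \<Rightarrow> bool" where
  "uniformly_clustering d h \<beta> \<Lambda> \<epsilon> \<longleftrightarrow>
    (\<forall>X A B l f g. X \<subseteq> \<Lambda> \<and> A \<subseteq> X \<and> B \<subseteq> X \<and> (\<forall>a\<in>A. \<forall>b\<in>B. l \<le> ldist a b)
       \<and> hermitian d A f \<and> hermitian d B g \<longrightarrow>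
       cov d X (gibbs d h \<beta> X) (ext_op A X f) (ext_op B X g)
         \<le> opnorm d A f * opnorm d B g * \<epsilon> l)"

(* belief propagation error: removing site y (with all terms touching it) is
   reproduced, up to gamma(l) = c1 exp(-c2 l) in trace norm, by conjugation with an
   operator eta supported on the ball of radius l around y;
   rho^{Y-{y}} is viewed on Y as rho^{Y-{y}} \<otimes> I_y / d_y *)
definition bp_error ::
  "('d::finite site \<Rightarrow> nat) \<Rightarrow> ('d site set \<Rightarrow> 'd op) \<Rightarrow> real \<Rightarrow> 'd site set \<Rightarrow> real \<Rightarrow> real \<Rightarrow> real \<Rightarrow> bool" where
  "bp_error d h \<beta> \<Lambda> c1 c2 M \<longleftrightarrow>
    (\<forall>Y y l. Y \<subseteq> \<Lambda> \<and> y \<in> Y \<and> 0 \<le> l \<longrightarrow>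
      (\<exists>\<eta>. let Bl = {z\<in>Y. ldist z y \<le> l}; E = ext_op Bl Y \<eta> in
         opnorm d Bl (mmult d Bl (madj \<eta>) \<eta>) \<le> M \<and>
         tnorm d Y (msub (\<lambda>s t. ext_op (Y - {y}) Y (gibbs d h \<beta> (Y - {y})) s t / of_nat (d y))
                         (mmult d Y (mmult d Y E (gibbs d h \<beta> Y)) (madj E)))
           \<le> c1 * exp (- c2 * l)))"

definition shields :: "'d::finite site set \<Rightarrow> 'd site set \<Rightarrow> 'd site set \<Rightarrow> 'd site set \<Rightarrow> real \<Rightarrow> bool" where
  "shields X A B C l \<longleftrightarrow> (\<forall>a\<in>A. \<forall>c\<in>C. l \<le> ldist a c) \<and>
     (\<forall>p. is_path X p \<and> hd p \<in> A \<and> last p \<in> C \<longrightarrow> set p \<inter> B \<noteq> {})"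

definition bdry :: "'d::finite site set \<Rightarrow> 'd site set \<Rightarrow> 'd site set" where
  "bdry B C = {c\<in>C. \<exists>b\<in>B. ldist b c = 1}"

end

theory Submission
  imports Defs
begin

text \<open>
  Tested against an observable \<open>f\<close> on \<open>A\<close> of norm at most 1, the sites of \<open>\<partial>C\<close> can be removed one at a
  time. If \<open>\<rho>'\<close> is obtained from \<open>\<rho>\<close> by removing \<open>y\<close> and \<open>\<eta>\<close> is the belief propagation operator of
  radius \<open>l/2\<close>, then \<open>tr (\<rho>' f)\<close> is \<open>\<gamma>\<close>-close to \<open>tr (\<eta> \<rho> \<eta>\<^sup>\<dagger> f) = tr (\<rho> f \<eta>\<^sup>\<dagger> \<eta>)\<close>, because \<open>\<eta>\<close> and \<open>f\<close>
  have disjoint supports. By clustering this is close to \<open>tr (\<rho> f) tr (\<rho> \<eta>\<^sup>\<dagger> \<eta>)\<close>, and the case \<open>f = 1\<close>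
  shows that the second factor is \<open>\<gamma>\<close>-close to 1. Once \<open>\<partial>C\<close> is gone no connected set meets both
  \<open>A \<union> B\<close> and the rest of \<open>C\<close>, so the Gibbs state is a product and its expectation of \<open>f\<close> is that of
  \<open>\<rho>\<^bsup>AB\<^esup>\<close>. Choosing \<open>f\<close> as the sign of the difference of the reduced states yields the trace norm.
\<close>

section \<open>Spectral theorem over a finite index set\<close>

text \<open>Vectors are total functions of which only the values on \<open>I\<close> count, so
  equalities of vectors are used only on \<open>I\<close> and enter through the congruence lemmas
  below. The form is conjugate-linear in its first argument.\<close>

definition cip :: "'a set \<Rightarrow> ('a \<Rightarrow> complex) \<Rightarrow> ('a \<Rightarrow> complex) \<Rightarrow> complex" where
  "cip I u v = (\<Sum>s\<in>I. cnj (u s) * v s)"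

definition nsq :: "'a set \<Rightarrow> ('a \<Rightarrow> complex) \<Rightarrow> real" where
  "nsq I v = (\<Sum>s\<in>I. (cmod (v s))\<^sup>2)"

definition mvec :: "'a set \<Rightarrow> ('a \<Rightarrow> 'a \<Rightarrow> complex) \<Rightarrow> ('a \<Rightarrow> complex) \<Rightarrow> 'a \<Rightarrow> complex" where
  "mvec I M v = (\<lambda>s. \<Sum>t\<in>I. M s t * v t)"

definition herm_on :: "'a set \<Rightarrow> ('a \<Rightarrow> 'a \<Rightarrow> complex) \<Rightarrow> bool" where
  "herm_on I M \<longleftrightarrow> (\<forall>s\<in>I. \<forall>t\<in>I. M s t = cnj (M t s))"

lemma mult_cnj_eq_cmod_sq: "z * cnj z = (complex_of_real (cmod z))\<^sup>2"
  by (metis complex_norm_square of_real_power)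

lemma nsq_nonneg: "0 \<le> nsq I v"
  by (simp add: nsq_def sum_nonneg)

lemma cip_self: "cip I v v = complex_of_real (nsq I v)"
  unfolding cip_def nsq_def of_real_sum
  by (rule sum.cong) (simp_all add: mult_cnj_eq_cmod_sq mult.commute[of "cnj _"])

lemma nsq_eq_0_iff: "finite I \<Longrightarrow> nsq I v = 0 \<longleftrightarrow> (\<forall>s\<in>I. v s = 0)"
  by (simp add: nsq_def sum_nonneg_eq_0_iff)

lemma cip_cnj: "cip I u v = cnj (cip I v u)"
  by (simp add: cip_def mult.commute)

lemma cip_cong: "(\<And>s. s \<in> I \<Longrightarrow> u s = u' s) \<Longrightarrow> (\<And>s. s \<in> I \<Longrightarrow> v s = v' s) \<Longrightarrow> cip I u v = cip I u' v'"
  by (simp add: cip_def cong: sum.cong)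

lemma nsq_cong: "(\<And>s. s \<in> I \<Longrightarrow> u s = u' s) \<Longrightarrow> nsq I u = nsq I u'"
  by (simp add: nsq_def cong: sum.cong)

lemma mvec_cong: "(\<And>s. s \<in> I \<Longrightarrow> u s = u' s) \<Longrightarrow> mvec I M u = mvec I M u'"
  by (simp add: mvec_def cong: sum.cong)

lemma cip_add_right: "cip I u (\<lambda>s. v s + w s) = cip I u v + cip I u w"
  by (simp add: cip_def algebra_simps sum.distrib)

lemma cip_add_left: "cip I (\<lambda>s. v s + w s) u = cip I v u + cip I w u"
  by (simp add: cip_def algebra_simps sum.distrib)

lemma cip_diff_right: "cip I u (\<lambda>s. v s - w s) = cip I u v - cip I u w"
  by (simp add: cip_def algebra_simps sum_subtractf)

lemma cip_scale_right: "cip I u (\<lambda>s. c * v s) = c * cip I u v"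
  by (simp add: cip_def algebra_simps sum_distrib_left)

lemma cip_scale_left: "cip I (\<lambda>s. c * v s) u = cnj c * cip I v u"
  by (simp add: cip_def algebra_simps sum_distrib_left)

lemma cip_sum_right: "cip I u (\<lambda>s. \<Sum>k\<in>K. f k s) = (\<Sum>k\<in>K. cip I u (f k))"
  unfolding cip_def sum_distrib_left by (rule sum.swap)

lemma mvec_add: "mvec I M (\<lambda>s. v s + w s) = (\<lambda>s. mvec I M v s + mvec I M w s)"
  by (simp add: mvec_def algebra_simps sum.distrib)

lemma mvec_diff: "mvec I M (\<lambda>s. v s - w s) = (\<lambda>s. mvec I M v s - mvec I M w s)"
  by (simp add: mvec_def algebra_simps sum_subtractf)

lemma mvec_scale: "mvec I M (\<lambda>s. c * v s) = (\<lambda>s. c * mvec I M v s)"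
  by (simp add: mvec_def algebra_simps sum_distrib_left)

lemma nsq_scale: "nsq I (\<lambda>s. c * v s) = (cmod c)\<^sup>2 * nsq I v"
  by (simp add: nsq_def norm_mult power_mult_distrib sum_distrib_left)

lemma cip_mvec_herm:
  assumes "herm_on I M"
  shows "cip I u (mvec I M v) = cip I (mvec I M u) v"
proof -
  have "cip I u (mvec I M v) = (\<Sum>s\<in>I. \<Sum>t\<in>I. cnj (u s) * (M s t * v t))"
    by (simp add: cip_def mvec_def sum_distrib_left)
  also have "\<dots> = (\<Sum>t\<in>I. \<Sum>s\<in>I. cnj (u s) * (M s t * v t))"
    by (rule sum.swap)
  also have "\<dots> = (\<Sum>t\<in>I. \<Sum>s\<in>I. cnj (M t s * u s) * v t)"
  proof (intro sum.cong refl)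
    fix s t assume "t \<in> I" "s \<in> I"
    then have "cnj (M t s) = M s t" using assms unfolding herm_on_def by metis
    then show "cnj (u s) * (M s t * v t) = cnj (M t s * u s) * v t"
      by (simp only: complex_cnj_mult) (simp add: mult_ac)
  qed
  finally show ?thesis by (simp add: cip_def mvec_def sum_distrib_right)
qed

lemma cip_Cauchy_Schwarz: "cmod (cip I u v) \<le> sqrt (nsq I u) * sqrt (nsq I v)"
proof -
  have "cmod (cip I u v) \<le> (\<Sum>s\<in>I. \<bar>cmod (u s)\<bar> * \<bar>cmod (v s)\<bar>)"
    unfolding cip_def by (rule order_trans[OF norm_sum]) (simp add: norm_mult)
  also have "\<dots> \<le> sqrt (nsq I u) * sqrt (nsq I v)"
    using L2_set_mult_ineq[of "\<lambda>s. cmod (u s)" "\<lambda>s. cmod (v s)" I]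
    by (simp add: L2_set_def nsq_def)
  finally show ?thesis .
qed

text \<open>A small \<open>t\<close> of sign opposite to \<open>a\<close> would let the linear term
  win. This is the first-order condition used at the maximiser of a quadratic form.\<close>

lemma nonneg_quadratic_linear_term_zero:
  fixes a b :: real
  assumes "\<And>t. 0 \<le> 2 * t * a + t\<^sup>2 * b"
  shows "a = 0"
proof (rule ccontr)
  assume a: "a \<noteq> 0"
  \<comment> \<open>Any positive \<open>c\<close> above \<open>b\<close> will do: at
    \<open>t = - a / c\<close> the quadratic term is at most \<open>a\<^sup>2 / c\<close>, half the
    size of the negative linear term.\<close>
  define c where "c = \<bar>b\<bar> + 1"
  have c: "c > 0" "b < c" by (auto simp: c_def)
  have "0 \<le> 2 * (- a / c) * a + (- a / c)\<^sup>2 * b" by (rule assms)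
  also have "\<dots> \<le> 2 * (- a / c) * a + (- a / c)\<^sup>2 * c"
    using c by (intro add_left_mono mult_left_mono) auto
  also have "\<dots> = - a\<^sup>2 / c" using c by (simp add: field_simps power2_eq_square)
  also have "\<dots> < 0" using a c by simp
  finally show False by simp
qed

text \<open>A maximiser of the quadratic form \<open>q\<close> over the unit vectors orthogonal to
  all \<open>e k\<close> is an eigenvector. Compactness yields the maximiser, \<open>w\<close> shows
  that such vectors exist, and \<open>inv\<close> keeps the residual of the eigenvalue equation in
  the orthogonal complement, where it is an admissible direction of variation.\<close>

lemma Rayleigh_eigenvector:
  fixes M :: "'a \<Rightarrow> 'a \<Rightarrow> complex"
  assumes I: "finite I" and M: "herm_on I M"
    and inv: "\<And>v. (\<And>k. k \<in> K \<Longrightarrow> cip I (e k) v = 0) \<Longrightarrow> (\<And>k. k \<in> K \<Longrightarrow> cip I (e k) (mvec I M v) = 0)"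
    and w: "\<And>k. k \<in> K \<Longrightarrow> cip I (e k) w = 0" "nsq I w \<noteq> 0"
  obtains v l where "nsq I v = 1" "\<And>k. k \<in> K \<Longrightarrow> cip I (e k) v = 0"
    "\<And>s. s \<in> I \<Longrightarrow> mvec I M v s = complex_of_real l * v s"
proof -
  \<comment> \<open>Vectors are required to vanish off \<open>I\<close> so that the unit sphere is compact in the product topology.\<close>
  define S where "S = {v. (\<forall>s. s \<notin> I \<longrightarrow> v s = 0) \<and> nsq I v = 1 \<and> (\<forall>k\<in>K. cip I (e k) v = 0)}"
  define q where "q v = Re (cip I v (mvec I M v))" for v
  have cont: "continuous_on UNIV (\<lambda>v::'a \<Rightarrow> complex. v s)" for s
    by simp
  have "compactin (product_topology (\<lambda>_::'a. euclidean) UNIV)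
      (Pi\<^sub>E UNIV (\<lambda>s. if s \<in> I then cball (0::complex) 1 else {0}))"
    by (subst compactin_PiE) auto
  then have cpt: "compact (Pi\<^sub>E UNIV (\<lambda>s. if s \<in> I then cball (0::complex) 1 else {0}))"
    by (simp add: euclidean_product_topology)
  have S1: "S = (\<Inter>s\<in>-I. {v. v s = 0}) \<inter> {v. nsq I v = 1} \<inter> (\<Inter>k\<in>K. {v. cip I (e k) v = 0})"
    by (auto simp: S_def)
  have clS: "closed S" unfolding S1 nsq_def cip_def
    by (intro closed_Int closed_INT ballI closed_Collect_eq continuous_intros cont)
  have "S \<subseteq> Pi\<^sub>E UNIV (\<lambda>s. if s \<in> I then cball (0::complex) 1 else {0})"
  proof
    fix v assume v: "v \<in> S"
    have "cmod (v s) \<le> 1" if "s \<in> I" for s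
    proof -
      have "(cmod (v s))\<^sup>2 \<le> nsq I v" unfolding nsq_def
        using I that by (intro member_le_sum) auto
      then show ?thesis using v by (auto simp: S_def abs_square_le_1)
    qed
    then show "v \<in> Pi\<^sub>E UNIV (\<lambda>s. if s \<in> I then cball (0::complex) 1 else {0})"
      using v by (auto simp: S_def)
  qed
  then have cS: "compact S" using cpt clS by (metis compact_Int_closed inf.absorb_iff2)
  have cq: "continuous_on S q" unfolding q_def cip_def mvec_def
    by (intro continuous_intros continuous_on_subset[OF cont]) auto
  have normalise: "(\<lambda>s. if s \<in> I then u s / sqrt (nsq I u) else 0) \<in> S"
    if "\<And>k. k \<in> K \<Longrightarrow> cip I (e k) u = 0" "nsq I u \<noteq> 0" for u
  proof -
    let ?c = "complex_of_real (1 / sqrt (nsq I u))"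
    have pos: "nsq I u > 0" using that(2) nsq_nonneg[of I u] by linarith
    have "nsq I (\<lambda>s. if s \<in> I then u s / sqrt (nsq I u) else 0) = nsq I (\<lambda>s. ?c * u s)"
      by (rule nsq_cong) simp
    also have "\<dots> = 1" using pos
      by (simp only: nsq_scale norm_of_real power2_abs) (simp add: power_divide)
    finally have 1: "nsq I (\<lambda>s. if s \<in> I then u s / sqrt (nsq I u) else 0) = 1" .
    have "cip I (e k) (\<lambda>s. if s \<in> I then u s / sqrt (nsq I u) else 0) = cip I (e k) (\<lambda>s. ?c * u s)" for k
      by (rule cip_cong) simp_all
    then have "cip I (e k) (\<lambda>s. if s \<in> I then u s / sqrt (nsq I u) else 0) = 0" if "k \<in> K" for k
      unfolding cip_scale_right using that \<open>\<And>k. k \<in> K \<Longrightarrow> cip I (e k) u = 0\<close> by simp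
    with 1 show ?thesis by (simp add: S_def)
  qed
  have "S \<noteq> {}" using normalise[OF w] by blast
  then obtain v where v: "v \<in> S" and vmax: "\<And>u. u \<in> S \<Longrightarrow> q u \<le> q v"
    using continuous_attains_sup[OF cS _ cq] by blast
  define l where "l = q v"
  \<comment> \<open>By homogeneity the maximum on the sphere bounds \<open>q\<close> on all
    admissible vectors.\<close>
  have ub: "q u \<le> l * nsq I u" if u: "\<And>k. k \<in> K \<Longrightarrow> cip I (e k) u = 0" for u
  proof (cases "nsq I u = 0")
    case True
    then have "\<forall>s\<in>I. u s = 0" using I by (simp add: nsq_eq_0_iff)
    then have "q u = 0" by (simp add: q_def cip_def)
    then show ?thesis using True by simp
  next
    case False
    let ?c = "complex_of_real (1 / sqrt (nsq I u))"
    have pos: "nsq I u > 0" using False nsq_nonneg[of I u] by linarith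
    have m: "mvec I M (\<lambda>s. if s \<in> I then u s / sqrt (nsq I u) else 0) = mvec I M (\<lambda>s. ?c * u s)"
      by (rule mvec_cong) simp
    have "cip I (\<lambda>s. if s \<in> I then u s / sqrt (nsq I u) else 0)
          (mvec I M (\<lambda>s. if s \<in> I then u s / sqrt (nsq I u) else 0)) =
        cip I (\<lambda>s. ?c * u s) (mvec I M (\<lambda>s. ?c * u s))"
      unfolding m by (rule cip_cong) simp_all
    also have "\<dots> = of_real (1 / nsq I u) * cip I u (mvec I M u)"
      using pos unfolding mvec_scale cip_scale_left cip_scale_right complex_cnj_complex_of_real mult.assoc[symmetric] of_real_mult[symmetric]
      by simp
    finally have "q (\<lambda>s. if s \<in> I then u s / sqrt (nsq I u) else 0) = q u / nsq I u"
      unfolding q_def by simp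
    moreover have "q (\<lambda>s. if s \<in> I then u s / sqrt (nsq I u) else 0) \<le> l"
      unfolding l_def by (rule vmax[OF normalise[OF u False]])
    ultimately show ?thesis using pos by (simp add: pos_divide_le_eq)
  qed
  \<comment> \<open>The residual of the eigenvalue equation. Inserting \<open>v + t z\<close> into
    \<open>ub\<close> gives a nonnegative quadratic in \<open>t\<close> without constant term, whose
    linear coefficient is \<open>2 * nsq I z\<close>.\<close>
  define z where "z s = l * v s - mvec I M v s" for s
  have vo: "\<And>k. k \<in> K \<Longrightarrow> cip I (e k) v = 0" and v1: "nsq I v = 1" using v by (auto simp: S_def)
  have zo: "cip I (e k) z = 0" if "k \<in> K" for k
    using vo inv[OF vo] that unfolding z_def cip_diff_right cip_scale_right by simp
  have "nsq I z = 0"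
  proof (rule nonneg_quadratic_linear_term_zero)
    fix t :: real
    let ?u = "\<lambda>s. v s + of_real t * z s"
    have uo: "cip I (e k) ?u = 0" if "k \<in> K" for k
      using vo zo that by (simp add: cip_add_right cip_scale_right)
    have n1: "nsq I ?u = Re (cip I ?u ?u)" by (simp add: cip_self)
    have zz: "cip I z z = of_real l * cip I z v - cip I z (mvec I M v)"
      unfolding cip_scale_right[symmetric] cip_diff_right[symmetric] z_def ..
    have sym: "cip I (mvec I M v) z = cnj (cip I z (mvec I M v))" "cip I v z = cnj (cip I z v)"
      by (rule cip_cnj)+
    have nu: "nsq I ?u = 1 + 2 * t * Re (cip I z v) + t\<^sup>2 * nsq I z"
      unfolding n1 cip_add_left cip_add_right cip_scale_left cip_scale_right sym
      by (simp add: cip_self v1 power2_eq_square algebra_simps)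
    have qu: "q ?u = l + 2 * t * Re (cip I z (mvec I M v)) + t\<^sup>2 * q z"
      unfolding q_def cip_add_left cip_add_right cip_scale_left cip_scale_right mvec_add mvec_scale
        cip_mvec_herm[OF M, of v z] sym l_def
      by (simp add: power2_eq_square algebra_simps)
    have "q ?u \<le> l * nsq I ?u" by (rule ub[OF uo])
    then have "0 \<le> 2 * t * (l * Re (cip I z v) - Re (cip I z (mvec I M v))) + t\<^sup>2 * (l * nsq I z - q z)"
      unfolding nu qu by (simp add: algebra_simps)
    also have "l * Re (cip I z v) - Re (cip I z (mvec I M v)) = nsq I z"
      using arg_cong[OF zz, of Re] by (simp add: cip_self)
    finally show "0 \<le> 2 * t * nsq I z + t\<^sup>2 * (l * nsq I z - q z)" .
  qed
  then have "\<forall>s\<in>I. z s = 0" using I by (simp add: nsq_eq_0_iff)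
  then have "mvec I M v s = complex_of_real l * v s" if "s \<in> I" for s using that by (simp add: z_def)
  then show thesis using that[OF v1 vo] by blast
qed

text \<open>Completeness is encoded as a resolution of the identity, the form in which it is
  inserted into matrix products, rather than as a spanning property.\<close>

definition orthonormal_basis :: "'a set \<Rightarrow> 'k set \<Rightarrow> ('k \<Rightarrow> 'a \<Rightarrow> complex) \<Rightarrow> bool" where
  "orthonormal_basis I K e \<longleftrightarrow> finite I \<and> finite K \<and>
     (\<forall>j\<in>K. \<forall>k\<in>K. cip I (e j) (e k) = of_bool (j = k)) \<and>
     (\<forall>s\<in>I. \<forall>t\<in>I. (\<Sum>k\<in>K. e k s * cnj (e k t)) = of_bool (s = t))"

text \<open>In bra-ket notation, the sum of \<open>a k\<close> |e_k><e_k|. Over an orthonormal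
  basis, products, traces and exponentials of such operators act on the coefficients alone.\<close>

definition diag_op :: "'k set \<Rightarrow> ('k \<Rightarrow> complex) \<Rightarrow> ('k \<Rightarrow> 'a \<Rightarrow> complex) \<Rightarrow> 'a \<Rightarrow> 'a \<Rightarrow> complex" where
  "diag_op K a e = (\<lambda>s t. \<Sum>k\<in>K. a k * e k s * cnj (e k t))"

lemma cip_orth_expansion:
  assumes "finite K" "\<And>j k. j \<in> K \<Longrightarrow> k \<in> K \<Longrightarrow> cip I (e j) (e k) = of_bool (j = k)" "j \<in> K"
  shows "cip I (e j) (\<lambda>s. \<Sum>k\<in>K. a k * e k s) = a j"
proof -
  have "cip I (e j) (\<lambda>s. \<Sum>k\<in>K. a k * e k s) = (\<Sum>k\<in>K. if j = k then a k else 0)"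
    unfolding cip_sum_right cip_scale_right
    by (rule sum.cong) (simp_all add: assms(2)[OF assms(3)])
  then show ?thesis using assms by simp
qed

text \<open>The defect of the inequality is the squared norm of \<open>v\<close> minus its
  projection \<open>p\<close>.\<close>

lemma Bessel:
  assumes I: "finite I" and K: "finite K"
    and e: "\<And>j k. j \<in> K \<Longrightarrow> k \<in> K \<Longrightarrow> cip I (e j) (e k) = of_bool (j = k)"
  shows "(\<Sum>k\<in>K. (cmod (cip I (e k) v))\<^sup>2) \<le> nsq I v"
proof -
  define p where "p s = (\<Sum>k\<in>K. cip I (e k) v * e k s)" for s
  define S where "S = (\<Sum>k\<in>K. (cmod (cip I (e k) v))\<^sup>2)"
  have pe: "cip I (e j) p = cip I (e j) v" if "j \<in> K" for j
    unfolding p_def using K e that by (rule cip_orth_expansion)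
  have 1: "cip I v p = of_real S"
    unfolding p_def S_def cip_sum_right cip_scale_right of_real_sum
    by (rule sum.cong) (simp_all add: mult_cnj_eq_cmod_sq cip_cnj[of I v])
  then have 2: "cip I p v = of_real S" using cip_cnj[of I p v] by simp
  have 3: "cip I p p = of_real S"
  proof -
    have "cip I p p = cip I p (\<lambda>s. \<Sum>k\<in>K. cip I (e k) v * e k s)"
      by (rule cip_cong) (simp_all add: p_def)
    also have "\<dots> = (\<Sum>k\<in>K. cip I (e k) v * cip I p (e k))"
      by (simp add: cip_sum_right cip_scale_right)
    also have "\<dots> = of_real S" unfolding S_def of_real_sum
      by (rule sum.cong) (simp_all add: mult_cnj_eq_cmod_sq cip_cnj[of I p] pe)
    finally show ?thesis .
  qed
  have "of_real (nsq I (\<lambda>s. v s + (-1) * p s)) = complex_of_real (nsq I v - S)"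
    unfolding cip_self[symmetric] cip_add_left cip_add_right cip_scale_left cip_scale_right 1 2 3
    by (simp add: cip_self)
  then have "nsq I (\<lambda>s. v s + (-1) * p s) = nsq I v - S" using of_real_eq_iff by blast
  then show ?thesis using nsq_nonneg[of I "\<lambda>s. v s + (-1) * p s"] unfolding S_def by linarith
qed

text \<open>\<open>M\<close> is applied to the resolution of the identity and acts on each
  \<open>e k\<close> as a scalar.\<close>

lemma eigenbasis_diag_op:
  assumes onb: "orthonormal_basis I K e"
    and ev: "\<And>k s. k \<in> K \<Longrightarrow> s \<in> I \<Longrightarrow> mvec I M (e k) s = a k * e k s"
    and s: "s \<in> I" and t: "t \<in> I"
  shows "M s t = diag_op K a e s t"
proof -
  have I: "finite I" and compl: "\<And>u. u \<in> I \<Longrightarrow> (\<Sum>k\<in>K. e k u * cnj (e k t)) = of_bool (u = t)"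
    using onb t by (auto simp: orthonormal_basis_def)
  have "M s t = (\<Sum>u\<in>I. M s u * of_bool (u = t))"
    using I t by (simp add: of_bool_def if_distrib cong: if_cong)
  also have "\<dots> = (\<Sum>u\<in>I. \<Sum>k\<in>K. M s u * e k u * cnj (e k t))"
    by (rule sum.cong) (simp_all add: compl[symmetric] sum_distrib_left mult.assoc)
  also have "\<dots> = (\<Sum>k\<in>K. mvec I M (e k) s * cnj (e k t))"
    unfolding mvec_def sum_distrib_right by (rule sum.swap)
  also have "\<dots> = diag_op K a e s t"
    unfolding diag_op_def using s by (intro sum.cong) (simp_all add: ev)
  finally show ?thesis .
qed

text \<open>An orthonormal family of eigenvectors of maximal length is complete: otherwise some
  coordinate vector has a nonzero component orthogonal to the family, and a further eigenvector
  exists in that complement.\<close>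

lemma spectral_theorem:
  assumes I: "finite I" and M: "herm_on I M"
  obtains n :: nat and a :: "nat \<Rightarrow> real" and e where "orthonormal_basis I {..<n} e"
    "\<And>s t. s \<in> I \<Longrightarrow> t \<in> I \<Longrightarrow> M s t = diag_op {..<n} (\<lambda>k. of_real (a k)) e s t"
proof -
  define P where "P n e a \<longleftrightarrow> (\<forall>j<n. \<forall>k<n. cip I (e j) (e k) = of_bool (j = k)) \<and>
     (\<forall>k<n. \<forall>s\<in>I. mvec I M (e k) s = complex_of_real (a k) * e k s)" for n :: nat and e a
  define \<delta> where "\<delta> t s = (of_bool (s = t) :: complex)" for t s :: 'a
  have cd: "cip I u (\<delta> t) = cnj (u t)" if "t \<in> I" for u t
    using I that by (simp add: cip_def \<delta>_def of_bool_def if_distrib cong: if_cong)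
  have nd: "nsq I (\<delta> t) = 1" if "t \<in> I" for t
    using I that by (simp add: nsq_def \<delta>_def of_bool_def if_distrib[of "\<lambda>x. x\<^sup>2"] if_distrib[of cmod] cong: if_cong)
  \<comment> \<open>Double counting: the total squared norm of the family is \<open>n\<close>, while
    Bessel for the coordinate vector at \<open>s\<close> bounds each row sum by 1. The bound
    guarantees that a maximal length exists.\<close>
  have bound: "n \<le> card I" if p: "P n e a" for n e a
  proof -
    have o: "cip I (e j) (e k) = of_bool (j = k)" if "j \<in> {..<n}" "k \<in> {..<n}" for j k
      using p that by (auto simp: P_def)
    have "real n = (\<Sum>k<n. nsq I (e k))"
    proof -
      have "nsq I (e k) = 1" if "k < n" for k
        using o[of k k] that unfolding cip_self by simp
      then show ?thesis by simp
    qed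
    also have "\<dots> = (\<Sum>s\<in>I. \<Sum>k<n. (cmod (e k s))\<^sup>2)" unfolding nsq_def by (rule sum.swap)
    also have "\<dots> \<le> (\<Sum>s\<in>I. 1)"
    proof (rule sum_mono)
      fix s assume s: "s \<in> I"
      show "(\<Sum>k<n. (cmod (e k s))\<^sup>2) \<le> 1"
        using Bessel[OF I _ o, where K = "{..<n}" and v = "\<delta> s"] s by (simp add: cd nd)
    qed
    finally show ?thesis by simp
  qed
  have P0: "\<exists>e a. P 0 e a" by (auto simp: P_def)
  define n where "n = (GREATEST n. \<exists>e a. P n e a)"
  have "\<exists>e a. P n e a" unfolding n_def
    by (rule GreatestI_nat[where b = "card I"]) (use P0 bound in auto)
  then obtain e a where p: "P n e a" by blast
  have nmax: "\<not> P (Suc n) e' a'" for e' a'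
  proof
    assume "P (Suc n) e' a'"
    then have "Suc n \<le> n" unfolding n_def
      by (intro Greatest_le_nat[where b = "card I"]) (use bound in auto)
    then show False by simp
  qed
  have o: "cip I (e j) (e k) = of_bool (j = k)" if "j \<in> {..<n}" "k \<in> {..<n}" for j k
    using p that by (auto simp: P_def)
  have ev: "mvec I M (e k) s = complex_of_real (a k) * e k s" if "k \<in> {..<n}" "s \<in> I" for k s
    using p that by (auto simp: P_def)
  have compl: "(\<Sum>k<n. e k s * cnj (e k t)) = of_bool (s = t)" if s: "s \<in> I" and t: "t \<in> I" for s t
  proof (rule ccontr)
    assume neq: "(\<Sum>k<n. e k s * cnj (e k t)) \<noteq> of_bool (s = t)"
    \<comment> \<open>The coordinate vector at \<open>t\<close> minus its projection onto the
      family; the failing entry of the resolution of the identity is its nonzero coordinate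
      \<open>s\<close>.\<close>
    define w where "w s = \<delta> t s - (\<Sum>k<n. cnj (e k t) * e k s)" for s
    have wo: "cip I (e j) w = 0" if "j \<in> {..<n}" for j
      unfolding w_def cip_diff_right cd[OF t] using cip_orth_expansion[OF _ o that, of "\<lambda>k. cnj (e k t)"] by simp
    have "w s \<noteq> 0" using neq by (simp add: w_def \<delta>_def mult.commute)
    then have w1: "nsq I w \<noteq> 0" using s I by (auto simp: nsq_eq_0_iff)
    \<comment> \<open>Self-adjointness moves \<open>M\<close> onto the eigenvector, so the
      orthogonal complement is invariant.\<close>
    have inv: "cip I (e k) (mvec I M v) = 0" if "\<And>k. k \<in> {..<n} \<Longrightarrow> cip I (e k) v = 0" "k \<in> {..<n}" for v k
    proof -
      have "cip I (e k) (mvec I M v) = cip I (\<lambda>s. of_real (a k) * e k s) v"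
        unfolding cip_mvec_herm[OF M] using that(2) by (intro cip_cong) (auto simp: ev)
      then show ?thesis using that by (simp add: cip_scale_left)
    qed
    obtain v l where v: "nsq I v = 1" "\<And>k. k \<in> {..<n} \<Longrightarrow> cip I (e k) v = 0"
        "\<And>s. s \<in> I \<Longrightarrow> mvec I M v s = complex_of_real l * v s"
      by (rule Rayleigh_eigenvector[OF I M, of "{..<n}" e w])
        (use inv wo w1 in \<open>simp_all (no_asm_use)\<close>, blast+)
    have v2: "cip I v (e k) = 0" if "k < n" for k using v(2)[of k] that cip_cnj[of I v] by simp
    have "P (Suc n) (e(n := v)) (a(n := l))"
      using v v2 o ev by (auto simp: P_def less_Suc_eq cip_self)
    then show False using nmax by blast
  qed
  have onb: "orthonormal_basis I {..<n} e"
    using I o compl by (simp add: orthonormal_basis_def)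
  show thesis by (rule that[OF onb eigenbasis_diag_op[OF onb ev]])
qed

section \<open>Trace norm, operator norm and Gibbs states through eigenbases\<close>

lemma diag_op_mult:
  assumes "orthonormal_basis I K e"
  shows "(\<Sum>u\<in>I. diag_op K a e s u * diag_op K b e u t) = diag_op K (\<lambda>k. a k * b k) e s t"
proof -
  have "(\<Sum>u\<in>I. diag_op K a e s u * diag_op K b e u t)
      = (\<Sum>u\<in>I. \<Sum>k\<in>K. \<Sum>j\<in>K. (a k * e k s * b j * cnj (e j t)) * (cnj (e k u) * e j u))"
    by (simp add: diag_op_def sum_product mult_ac)
  also have "\<dots> = (\<Sum>k\<in>K. \<Sum>u\<in>I. \<Sum>j\<in>K. (a k * e k s * b j * cnj (e j t)) * (cnj (e k u) * e j u))"
    by (rule sum.swap)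
  also have "\<dots> = (\<Sum>k\<in>K. \<Sum>j\<in>K. (a k * e k s * b j * cnj (e j t)) * cip I (e k) (e j))"
    unfolding cip_def sum_distrib_left by (intro sum.cong refl sum.swap)
  also have "\<dots> = (\<Sum>k\<in>K. \<Sum>j\<in>K. if k = j then a k * e k s * b j * cnj (e j t) else 0)"
    using assms by (intro sum.cong refl) (auto simp: orthonormal_basis_def)
  also have "\<dots> = diag_op K (\<lambda>k. a k * b k) e s t"
    using assms by (simp add: diag_op_def orthonormal_basis_def mult_ac)
  finally show ?thesis .
qed

lemma diag_op_one:
  "orthonormal_basis I K e \<Longrightarrow> s \<in> I \<Longrightarrow> t \<in> I \<Longrightarrow> diag_op K (\<lambda>_. 1) e s t = of_bool (s = t)"
  by (simp add: diag_op_def orthonormal_basis_def)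

lemma diag_op_trace_mult:
  "(\<Sum>s\<in>I. \<Sum>t\<in>I. F s t * diag_op K a e t s) = (\<Sum>k\<in>K. a k * cip I (e k) (mvec I F (e k)))"
proof -
  have "(\<Sum>s\<in>I. \<Sum>t\<in>I. F s t * diag_op K a e t s)
      = (\<Sum>s\<in>I. \<Sum>k\<in>K. \<Sum>t\<in>I. a k * (cnj (e k s) * (F s t * e k t)))"
    unfolding diag_op_def sum_distrib_left
    by (rule sum.cong[OF refl], subst sum.swap) (simp add: mult_ac)
  also have "\<dots> = (\<Sum>k\<in>K. \<Sum>s\<in>I. \<Sum>t\<in>I. a k * (cnj (e k s) * (F s t * e k t)))"
    by (rule sum.swap)
  finally show ?thesis by (simp add: cip_def mvec_def sum_distrib_left)
qed

lemma diag_op_trace: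
  assumes "orthonormal_basis I K e"
  shows "(\<Sum>s\<in>I. diag_op K a e s s) = (\<Sum>k\<in>K. a k)"
proof -
  have "(\<Sum>s\<in>I. diag_op K a e s s) = (\<Sum>k\<in>K. a k * cip I (e k) (e k))"
    unfolding diag_op_def cip_def sum_distrib_left by (subst sum.swap) (simp add: mult_ac)
  then show ?thesis using assms by (simp add: orthonormal_basis_def)
qed

lemma mvec_diag_op: "mvec I (diag_op K a e) v = (\<lambda>s. \<Sum>k\<in>K. a k * cip I (e k) v * e k s)"
  unfolding fun_eq_iff mvec_def diag_op_def cip_def sum_distrib_left sum_distrib_right
  by (subst sum.swap) (simp add: mult_ac)

lemma diag_op_eigenvector:
  assumes "orthonormal_basis I K e" "k \<in> K"
  shows "mvec I (diag_op K a e) (e k) s = a k * e k s"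
proof -
  have "mvec I (diag_op K a e) (e k) s = (\<Sum>j\<in>K. if j = k then a j * e j s else 0)"
    unfolding mvec_diag_op using assms by (intro sum.cong) (auto simp: orthonormal_basis_def)
  then show ?thesis using assms by (simp add: orthonormal_basis_def)
qed

lemma nsq_expansion:
  assumes "orthonormal_basis I K e"
  shows "nsq I (\<lambda>s. \<Sum>k\<in>K. b k * e k s) = (\<Sum>k\<in>K. (cmod (b k))\<^sup>2)"
proof -
  define p where "p = (\<lambda>s. \<Sum>k\<in>K. b k * e k s)"
  have "cip I (e k) p = b k" if "k \<in> K" for k
    unfolding p_def using assms that by (intro cip_orth_expansion) (auto simp: orthonormal_basis_def)
  then have pe: "cip I p (e k) = cnj (b k)" if "k \<in> K" for k
    using that cip_cnj[of I p "e k"] by simp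
  have "cip I p p = (\<Sum>k\<in>K. b k * cip I p (e k))"
    by (subst (2) p_def) (simp add: cip_sum_right cip_scale_right)
  also have "\<dots> = of_real (\<Sum>k\<in>K. (cmod (b k))\<^sup>2)"
    by (simp add: pe mult_cnj_eq_cmod_sq)
  finally have "complex_of_real (nsq I p) = of_real (\<Sum>k\<in>K. (cmod (b k))\<^sup>2)"
    unfolding cip_self .
  then show ?thesis unfolding p_def using of_real_eq_iff by blast
qed

lemma Parseval:
  assumes onb: "orthonormal_basis I K e"
  shows "nsq I v = (\<Sum>k\<in>K. (cmod (cip I (e k) v))\<^sup>2)"
proof -
  have I: "finite I" using onb by (simp add: orthonormal_basis_def)
  have "v s = (\<Sum>k\<in>K. cip I (e k) v * e k s)" if s: "s \<in> I" for s
  proof -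
    have "(\<Sum>k\<in>K. cip I (e k) v * e k s) = mvec I (diag_op K (\<lambda>_. 1) e) v s"
      by (simp add: mvec_diag_op)
    also have "\<dots> = (\<Sum>t\<in>I. if s = t then v t else 0)"
      unfolding mvec_def using s by (intro sum.cong) (auto simp: diag_op_one[OF onb])
    also have "\<dots> = v s" using I s by simp
    finally show ?thesis by simp
  qed
  then have "nsq I v = nsq I (\<lambda>s. \<Sum>k\<in>K. cip I (e k) v * e k s)" by (rule nsq_cong)
  then show ?thesis unfolding nsq_expansion[OF onb] .
qed

lemma herm_on_diag_op:
  assumes "\<And>s t. s \<in> I \<Longrightarrow> t \<in> I \<Longrightarrow> M s t = diag_op K (\<lambda>k. complex_of_real (a k)) e s t"
  shows "herm_on I M"
  by (simp add: herm_on_def assms) (simp add: diag_op_def mult_ac)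

text \<open>Operator norm at most 1, phrased without a supremum so that it can be used on arbitrary
  vectors and passed to larger regions directly.\<close>

definition contraction :: "'a set \<Rightarrow> ('a \<Rightarrow> 'a \<Rightarrow> complex) \<Rightarrow> bool" where
  "contraction I F \<longleftrightarrow> (\<forall>v. nsq I (mvec I F v) \<le> nsq I v)"

lemma contraction_diag_op:
  assumes onb: "orthonormal_basis I K e" and a: "\<And>k. k \<in> K \<Longrightarrow> cmod (a k) \<le> 1"
  shows "contraction I (diag_op K a e)"
  unfolding contraction_def
proof
  fix v
  have "nsq I (mvec I (diag_op K a e) v) = nsq I (\<lambda>s. \<Sum>k\<in>K. (a k * cip I (e k) v) * e k s)"
    by (rule nsq_cong) (simp add: mvec_diag_op)
  also have "\<dots> = (\<Sum>k\<in>K. (cmod (a k))\<^sup>2 * (cmod (cip I (e k) v))\<^sup>2)"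
    unfolding nsq_expansion[OF onb] by (simp add: norm_mult power_mult_distrib)
  also have "\<dots> \<le> (\<Sum>k\<in>K. 1 * (cmod (cip I (e k) v))\<^sup>2)"
    using a by (intro sum_mono mult_right_mono) (auto simp: abs_square_le_1)
  also have "\<dots> = nsq I v" by (simp add: Parseval[OF onb])
  finally show "nsq I (mvec I (diag_op K a e) v) \<le> nsq I v" .
qed

lemma contraction_numerical_radius:
  assumes "contraction I F" "nsq I v = 1"
  shows "cmod (cip I v (mvec I F v)) \<le> 1"
proof -
  have "cmod (cip I v (mvec I F v)) \<le> sqrt (nsq I v) * sqrt (nsq I (mvec I F v))"
    by (rule cip_Cauchy_Schwarz)
  also have "\<dots> \<le> 1" using assms by (simp add: contraction_def) (metis)
  finally show ?thesis .
qed

text \<open>In the eigenbasis the trace is a combination of the diagonal elements <e_k, F e_k>, each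
  of modulus at most 1. This serves for trace-norm duality and, with Boltzmann weights as
  coefficients, for bounding expectations.\<close>

lemma contraction_trace_diag_op:
  assumes F: "contraction I F" and onb: "orthonormal_basis I K e"
  shows "cmod (\<Sum>s\<in>I. \<Sum>t\<in>I. F s t * diag_op K a e t s) \<le> (\<Sum>k\<in>K. cmod (a k))"
  unfolding diag_op_trace_mult
proof (rule order_trans[OF norm_sum sum_mono])
  fix k assume "k \<in> K"
  then have "cip I (e k) (e k) = 1" using onb by (simp add: orthonormal_basis_def)
  then have "nsq I (e k) = 1" unfolding cip_self by simp
  then have "cmod (a k) * cmod (cip I (e k) (mvec I F (e k))) \<le> cmod (a k) * 1"
    by (intro mult_left_mono contraction_numerical_radius[OF F]) auto
  then show "cmod (a k * cip I (e k) (mvec I F (e k))) \<le> cmod (a k)" by (simp add: norm_mult)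
qed

section \<open>Uniqueness of positive square roots and the value of the trace norm\<close>

definition psd_on :: "'a set \<Rightarrow> ('a \<Rightarrow> 'a \<Rightarrow> complex) \<Rightarrow> bool" where
  "psd_on I R \<longleftrightarrow> herm_on I R \<and> (\<forall>v. 0 \<le> Re (cip I v (mvec I R v)))"

lemma mvec_mvec: "mvec I M (mvec I N v) s = (\<Sum>t\<in>I. (\<Sum>u\<in>I. M s u * N u t) * v t)"
  unfolding mvec_def sum_distrib_left sum_distrib_right
  by (subst sum.swap) (simp add: mult_ac)

text \<open>The trace norm is defined by a definite description, which needs this uniqueness. On an
  eigenvector of \<open>R\<close> with value \<open>a k\<close>, the residual \<open>w\<close> of
  \<open>S\<close> satisfies S w = - a_k w, so positivity of \<open>S\<close> forces
  \<open>w\<close> to vanish if \<open>a k\<close> is positive. If \<open>a k\<close> is zero, the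
  squared norm of S e_k is <e_k, S S e_k> = 0. Hence \<open>S\<close> has the same eigenbasis and
  eigenvalues.\<close>

lemma psd_sqrt_unique:
  assumes I: "finite I" and R: "psd_on I R" and S: "psd_on I S"
    and sq: "\<And>s t. s \<in> I \<Longrightarrow> t \<in> I \<Longrightarrow> (\<Sum>u\<in>I. R s u * R u t) = (\<Sum>u\<in>I. S s u * S u t)"
    and s: "s \<in> I" and t: "t \<in> I"
  shows "R s t = S s t"
proof -
  have hR: "herm_on I R" and hS: "herm_on I S" using R S by (auto simp: psd_on_def)
  obtain n :: nat and a :: "nat \<Rightarrow> real" and e where onb: "orthonormal_basis I {..<n} e"
    and Rd: "\<And>s t. s \<in> I \<Longrightarrow> t \<in> I \<Longrightarrow> R s t = diag_op {..<n} (\<lambda>k. of_real (a k)) e s t"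
    using spectral_theorem[OF I hR] by metis
  have ev: "mvec I S (e k) s = of_real (a k) * e k s" if k: "k \<in> {..<n}" and s: "s \<in> I" for k s
  proof -
    have Re: "mvec I R (e k) s = of_real (a k) * e k s" if "s \<in> I" for s
    proof -
      have "mvec I R (e k) s = mvec I (diag_op {..<n} (\<lambda>k. of_real (a k)) e) (e k) s"
        unfolding mvec_def using that by (intro sum.cong) (auto simp: Rd)
      then show ?thesis by (simp add: diag_op_eigenvector[OF onb k])
    qed
    have RR: "mvec I R (mvec I R (e k)) s = of_real (a k) * (of_real (a k) * e k s)" if "s \<in> I" for s
    proof -
      have "mvec I R (mvec I R (e k)) = mvec I R (\<lambda>s. of_real (a k) * e k s)"
        by (rule mvec_cong) (simp add: Re)
      then show ?thesis using Re[OF that] by (simp add: mvec_scale)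
    qed
    have SS: "mvec I S (mvec I S (e k)) s = of_real (a k) * (of_real (a k) * e k s)" if "s \<in> I" for s
      unfolding RR[OF that, symmetric] mvec_mvec using that by (intro sum.cong) (auto simp: sq)
    have n1: "nsq I (e k) = 1"
    proof -
      have "cip I (e k) (e k) = 1" using onb k by (simp add: orthonormal_basis_def)
      then show ?thesis unfolding cip_self by simp
    qed
    have "cip I (e k) (mvec I R (e k)) = cip I (e k) (\<lambda>s. of_real (a k) * e k s)"
      by (rule cip_cong) (simp_all add: Re)
    also have "\<dots> = of_real (a k)" by (simp add: cip_scale_right cip_self n1)
    finally have a0: "0 \<le> a k" using R unfolding psd_on_def by (metis Re_complex_of_real)
    define w where "w s = mvec I S (e k) s - of_real (a k) * e k s" for s
    have "nsq I w = 0"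
    proof (cases "a k = 0")
      case True
      have "of_real (nsq I w) = cip I (mvec I S (e k)) (mvec I S (e k))"
        unfolding cip_self[symmetric] by (rule cip_cong) (simp_all add: w_def True)
      also have "\<dots> = cip I (e k) (mvec I S (mvec I S (e k)))"
        by (rule cip_mvec_herm[OF hS, symmetric])
      also have "\<dots> = cip I (e k) (\<lambda>s. 0)"
        by (rule cip_cong) (simp_all add: SS True)
      finally show ?thesis by (simp add: cip_def)
    next
      case False
      have "mvec I S w s = - of_real (a k) * w s" if "s \<in> I" for s
        using SS[OF that] unfolding w_def mvec_diff mvec_scale by (simp add: algebra_simps)
      then have "cip I w (mvec I S w) = cip I w (\<lambda>s. - of_real (a k) * w s)"
        by (intro cip_cong) simp_all
      also have "\<dots> = of_real (- (a k * nsq I w))"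
        unfolding cip_scale_right cip_self by simp
      finally have "0 \<le> - (a k * nsq I w)" using S unfolding psd_on_def
        by (metis Re_complex_of_real)
      then have "nsq I w \<le> 0" using False a0
        by (metis less_le neg_0_le_iff_le mult_le_0_iff not_less)
      then show ?thesis using nsq_nonneg[of I w] by linarith
    qed
    then have "w s = 0" using I s by (simp add: nsq_eq_0_iff)
    then show ?thesis by (simp add: w_def)
  qed
  show ?thesis using Rd[OF s t] eigenbasis_diag_op[OF onb ev s t] by simp
qed

lemma hermitian_iff: "hermitian d Y M \<longleftrightarrow> herm_on (cfgs d Y) M"
  by (simp add: hermitian_def herm_on_def)

lemma psd_iff: "psd d Y R \<longleftrightarrow> psd_on (cfgs d Y) R"
  by (simp add: psd_def psd_on_def hermitian_iff cip_def mvec_def sum_distrib_left mult.assoc)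

text \<open>The positive square root of \<open>mmult d Y (madj M) M\<close> keeps the eigenbasis and
  replaces each eigenvalue of \<open>M\<close> by its modulus.\<close>

lemma tnorm_diag_op:
  assumes onb: "orthonormal_basis (cfgs d Y) K e"
    and M: "\<And>s t. s \<in> cfgs d Y \<Longrightarrow> t \<in> cfgs d Y \<Longrightarrow> M s t = diag_op K (\<lambda>k. complex_of_real (a k)) e s t"
  shows "tnorm d Y M = (\<Sum>k\<in>K. \<bar>a k\<bar>)"
proof -
  let ?I = "cfgs d Y"
  have I: "finite ?I" using onb by (simp add: orthonormal_basis_def)
  define D where "D = diag_op K (\<lambda>k. complex_of_real \<bar>a k\<bar>) e"
  \<comment> \<open>The description inside \<open>tnorm\<close> prescribes the value 0 off the
    configurations, so the candidate must be cut off there.\<close>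
  define R where "R = (\<lambda>s t. if s \<in> ?I \<and> t \<in> ?I then D s t else 0)"
  have hR: "herm_on ?I R"
    by (rule herm_on_diag_op[where a = "\<lambda>k. \<bar>a k\<bar>" and K = K and e = e]) (simp add: R_def D_def)
  have pR: "psd_on ?I R" unfolding psd_on_def
  proof (intro conjI allI hR)
    fix v
    have "mvec ?I R v s = mvec ?I D v s" if "s \<in> ?I" for s
      unfolding mvec_def using that by (intro sum.cong) (auto simp: R_def)
    then have "cip ?I v (mvec ?I R v) = cip ?I v (mvec ?I D v)" by (intro cip_cong) auto
    also have "\<dots> = (\<Sum>k\<in>K. of_real \<bar>a k\<bar> * (cip ?I (e k) v * cip ?I v (e k)))"
      by (simp add: D_def mvec_diag_op cip_sum_right cip_scale_right mult.assoc)
    also have "\<dots> = of_real (\<Sum>k\<in>K. \<bar>a k\<bar> * (cmod (cip ?I (e k) v))\<^sup>2)"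
      by (simp add: cip_cnj[of _ v] mult_cnj_eq_cmod_sq)
    finally show "0 \<le> Re (cip ?I v (mvec ?I R v))" by (simp add: sum_nonneg)
  qed
  have sq: "mmult d Y R R s t = mmult d Y (madj M) M s t" if s: "s \<in> ?I" and t: "t \<in> ?I" for s t
  proof -
    have "mmult d Y R R s t = (\<Sum>u\<in>?I. D s u * D u t)"
      unfolding mmult_def using s t by (intro sum.cong) (auto simp: R_def)
    also have "\<dots> = diag_op K (\<lambda>k. of_real (a k) * of_real (a k)) e s t"
      unfolding D_def diag_op_mult[OF onb] by (simp flip: of_real_mult)
    also have "\<dots> = (\<Sum>u\<in>?I. M s u * M u t)"
      unfolding diag_op_mult[OF onb, symmetric] using s t by (intro sum.cong) (auto simp: M)
    also have "\<dots> = mmult d Y (madj M) M s t"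
    proof -
      have "herm_on ?I M" using M by (rule herm_on_diag_op)
      then have "cnj (M u s) = M s u" if "u \<in> ?I" for u using s that unfolding herm_on_def by metis
      then show ?thesis unfolding mmult_def madj_def by (intro sum.cong) auto
    qed
    finally show ?thesis .
  qed
  have "(THE R. psd d Y R \<and> (\<forall>s t. s \<notin> ?I \<or> t \<notin> ?I \<longrightarrow> R s t = 0)
      \<and> (\<forall>s\<in>?I. \<forall>t\<in>?I. mmult d Y R R s t = mmult d Y (madj M) M s t)) = R"
  proof (rule the_equality, goal_cases)
    case 1
    show ?case using pR sq by (auto simp: psd_iff R_def)
  next
    case (2 S)
    show ?case
    proof (intro ext)
      fix s t
      show "S s t = R s t"
      proof (cases "s \<in> ?I \<and> t \<in> ?I")
        case True
        show ?thesis
          by (rule psd_sqrt_unique[OF I _ pR]) (use 2 sq True in \<open>auto simp: psd_iff mmult_def\<close>)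
      qed (use 2 in \<open>auto simp: R_def\<close>)
    qed
  qed
  then have "tnorm d Y M = Re (mtr d Y R)" by (simp add: tnorm_def)
  also have "mtr d Y R = (\<Sum>s\<in>?I. D s s)" unfolding mtr_def by (rule sum.cong) (auto simp: R_def)
  also have "\<dots> = of_real (\<Sum>k\<in>K. \<bar>a k\<bar>)" unfolding D_def diag_op_trace[OF onb] by simp
  finally show ?thesis by simp
qed

lemma mtr_mmult: "mtr d Y (mmult d Y F M) = (\<Sum>s\<in>cfgs d Y. \<Sum>t\<in>cfgs d Y. F s t * M t s)"
  by (simp add: mtr_def mmult_def)

text \<open>The witness is the sign of \<open>M\<close> in its eigenbasis: multiplied with
  \<open>M\<close> it gives the modulus of \<open>M\<close>.\<close>

lemma tnorm_attained:
  assumes I: "finite (cfgs d Y)" and M: "hermitian d Y M"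
  obtains f where "hermitian d Y f" "contraction (cfgs d Y) f" "tnorm d Y M = Re (mtr d Y (mmult d Y f M))"
proof -
  let ?I = "cfgs d Y"
  obtain n :: nat and a :: "nat \<Rightarrow> real" and e where onb: "orthonormal_basis ?I {..<n} e"
    and Md: "\<And>s t. s \<in> ?I \<Longrightarrow> t \<in> ?I \<Longrightarrow> M s t = diag_op {..<n} (\<lambda>k. of_real (a k)) e s t"
    using spectral_theorem[OF I] M unfolding hermitian_iff by metis
  define f where "f = diag_op {..<n} (\<lambda>k. complex_of_real (sgn (a k))) e"
  have "hermitian d Y f" unfolding hermitian_iff
    by (rule herm_on_diag_op) (simp add: f_def)
  moreover have "contraction ?I f" unfolding f_def
    by (rule contraction_diag_op[OF onb]) (simp add: sgn_if)
  moreover have "mtr d Y (mmult d Y f M) = (\<Sum>s\<in>?I. \<Sum>t\<in>?I. f s t * diag_op {..<n} (\<lambda>k. of_real (a k)) e t s)"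
    unfolding mtr_mmult by (intro sum.cong refl) (simp add: Md)
  then have "mtr d Y (mmult d Y f M) = of_real (\<Sum>k<n. \<bar>a k\<bar>)"
    unfolding f_def diag_op_mult[OF onb] diag_op_trace[OF onb] by (simp flip: of_real_mult add: abs_sgn mult.commute)
  then have "tnorm d Y M = Re (mtr d Y (mmult d Y f M))"
    using tnorm_diag_op[OF onb Md] by simp
  ultimately show thesis using that by blast
qed

text \<open>The upper half of trace-norm duality; \<open>tnorm_attained\<close> is the other
  half.\<close>

lemma trace_le_tnorm:
  assumes I: "finite (cfgs d Y)" and M: "hermitian d Y M" and F: "contraction (cfgs d Y) F"
  shows "cmod (mtr d Y (mmult d Y F M)) \<le> tnorm d Y M"
proof -
  let ?I = "cfgs d Y"
  obtain n :: nat and a :: "nat \<Rightarrow> real" and e where onb: "orthonormal_basis ?I {..<n} e"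
    and Md: "\<And>s t. s \<in> ?I \<Longrightarrow> t \<in> ?I \<Longrightarrow> M s t = diag_op {..<n} (\<lambda>k. of_real (a k)) e s t"
    using spectral_theorem[OF I] M unfolding hermitian_iff by metis
  have "mtr d Y (mmult d Y F M) = (\<Sum>s\<in>?I. \<Sum>t\<in>?I. F s t * diag_op {..<n} (\<lambda>k. of_real (a k)) e t s)"
    unfolding mtr_mmult by (intro sum.cong refl) (simp add: Md)
  then show ?thesis
    using contraction_trace_diag_op[OF F onb, of "\<lambda>k. of_real (a k)"] tnorm_diag_op[OF onb Md] by simp
qed

section \<open>Bounds on the operator norm\<close>

lemma opnorm_eq: "opnorm d Y M = Sup {sqrt (nsq (cfgs d Y) (mvec (cfgs d Y) M v)) | v. nsq (cfgs d Y) v = 1}"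
  by (simp add: opnorm_def nsq_def mvec_def)

lemma ex_unit_vector: "finite I \<Longrightarrow> I \<noteq> {} \<Longrightarrow> \<exists>v. nsq I v = 1"
proof -
  assume I: "finite I" "I \<noteq> {}"
  then obtain t where "t \<in> I" by blast
  then have "nsq I (\<lambda>s. if s = t then 1 else 0) = 1"
    using I by (simp add: nsq_def if_distrib[of "\<lambda>x. x\<^sup>2"] if_distrib[of cmod] cong: if_cong)
  then show ?thesis by blast
qed

lemma opnorm_le_1:
  assumes "finite (cfgs d Y)" "cfgs d Y \<noteq> {}" "contraction (cfgs d Y) F"
  shows "opnorm d Y F \<le> 1"
  unfolding opnorm_eq
proof (rule cSup_least)
  show "{sqrt (nsq (cfgs d Y) (mvec (cfgs d Y) F v)) |v. nsq (cfgs d Y) v = 1} \<noteq> {}"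
    using ex_unit_vector[OF assms(1,2)] by auto
qed (use assms(3) in \<open>auto simp: contraction_def; metis\<close>)

lemma opnorm_nonneg:
  assumes I: "finite (cfgs d Y)" "cfgs d Y \<noteq> {}"
  shows "0 \<le> opnorm d Y M"
proof -
  let ?I = "cfgs d Y"
  obtain v where v: "nsq ?I v = 1" using ex_unit_vector[OF I] by blast
  \<comment> \<open>A real \<open>Sup\<close> dominates the members of a set only if the set is
    bounded. The Frobenius norm is a bound, by Cauchy-Schwarz on each row of
    \<open>M\<close>.\<close>
  have bdd: "bdd_above {sqrt (nsq ?I (mvec ?I M v)) |v. nsq ?I v = 1}"
  proof (rule bdd_aboveI, clarify)
    fix v assume v: "nsq ?I v = 1"
    have "nsq ?I (mvec ?I M v) \<le> (\<Sum>s\<in>?I. nsq ?I (\<lambda>t. cnj (M s t)))"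
      unfolding nsq_def[of ?I "mvec ?I M v"]
    proof (rule sum_mono)
      fix s
      have "cmod (mvec ?I M v s) \<le> sqrt (nsq ?I (\<lambda>t. cnj (M s t))) * sqrt (nsq ?I v)"
        using cip_Cauchy_Schwarz[of ?I "\<lambda>t. cnj (M s t)" v] by (simp add: cip_def mvec_def)
      then have "(cmod (mvec ?I M v s))\<^sup>2 \<le> (sqrt (nsq ?I (\<lambda>t. cnj (M s t))))\<^sup>2"
        using v by (intro power_mono) auto
      then show "(cmod (mvec ?I M v s))\<^sup>2 \<le> nsq ?I (\<lambda>t. cnj (M s t))"
        by (simp add: nsq_nonneg)
    qed
    then show "sqrt (nsq ?I (mvec ?I M v)) \<le> sqrt (\<Sum>s\<in>?I. nsq ?I (\<lambda>t. cnj (M s t)))" by simp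
  qed
  have "0 \<le> sqrt (nsq ?I (mvec ?I M v))" by (simp add: nsq_nonneg)
  also have "\<dots> \<le> opnorm d Y M" unfolding opnorm_eq
    by (rule cSup_upper[OF _ bdd]) (use v in auto)
  finally show ?thesis .
qed

section \<open>Matrix exponentials and Gibbs states\<close>

lemma mpow_diag_op:
  assumes onb: "orthonormal_basis (cfgs d Y) K e"
    and M: "\<And>s t. s \<in> cfgs d Y \<Longrightarrow> t \<in> cfgs d Y \<Longrightarrow> M s t = diag_op K a e s t"
    and s: "s \<in> cfgs d Y" and t: "t \<in> cfgs d Y"
  shows "mpow d Y M n s t = diag_op K (\<lambda>k. a k ^ n) e s t"
  using s
proof (induction n arbitrary: s)
  case 0
  then show ?case using t by (simp add: mone_def diag_op_one[OF onb])
next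
  case (Suc n)
  have "mpow d Y M (Suc n) s t = (\<Sum>u\<in>cfgs d Y. diag_op K a e s u * diag_op K (\<lambda>k. a k ^ n) e u t)"
    unfolding mpow.simps mmult_def using Suc by (intro sum.cong) (auto simp: M)
  then show ?case by (simp add: diag_op_mult[OF onb])
qed

text \<open>Each matrix entry of the series is a finite combination of scalar exponential series,
  one for each eigenvalue.\<close>

lemma mexp_diag_op:
  assumes onb: "orthonormal_basis (cfgs d Y) K e"
    and M: "\<And>s t. s \<in> cfgs d Y \<Longrightarrow> t \<in> cfgs d Y \<Longrightarrow> M s t = diag_op K a e s t"
    and s: "s \<in> cfgs d Y" and t: "t \<in> cfgs d Y"
  shows "mexp d Y M s t = diag_op K (\<lambda>k. exp (a k)) e s t"
proof -
  have "(\<lambda>n. \<Sum>k\<in>K. (a k ^ n /\<^sub>R fact n) * (e k s * cnj (e k t))) sums (\<Sum>k\<in>K. exp (a k) * (e k s * cnj (e k t)))"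
    by (intro sums_sum sums_mult2 exp_converges)
  also have "(\<lambda>n. \<Sum>k\<in>K. (a k ^ n /\<^sub>R fact n) * (e k s * cnj (e k t))) = (\<lambda>n. mpow d Y M n s t / of_nat (fact n))"
    by (simp add: mpow_diag_op[OF onb M s t] diag_op_def scaleR_conv_of_real sum_divide_distrib field_simps)
  finally show ?thesis unfolding mexp_def diag_op_def by (simp add: sums_iff mult.assoc)
qed

lemma gibbs_diag_op:
  assumes onb: "orthonormal_basis (cfgs d Y) K e"
    and H: "\<And>s t. s \<in> cfgs d Y \<Longrightarrow> t \<in> cfgs d Y \<Longrightarrow> ham d h Y s t = diag_op K (\<lambda>k. complex_of_real (a k)) e s t"
    and s: "s \<in> cfgs d Y" and t: "t \<in> cfgs d Y"
  shows "gibbs d h \<beta> Y s t =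
    diag_op K (\<lambda>k. complex_of_real (exp (- \<beta> * a k) / (\<Sum>j\<in>K. exp (- \<beta> * a j)))) e s t"
proof -
  have E: "mexp d Y (\<lambda>s t. - of_real \<beta> * ham d h Y s t) s t = diag_op K (\<lambda>k. complex_of_real (exp (- \<beta> * a k))) e s t"
    if "s \<in> cfgs d Y" "t \<in> cfgs d Y" for s t
    unfolding exp_of_real[symmetric]
    by (rule mexp_diag_op[OF onb _ that]) (simp add: H diag_op_def sum_distrib_left sum_negf mult.assoc)
  have "mtr d Y (mexp d Y (\<lambda>s t. - of_real \<beta> * ham d h Y s t))
      = (\<Sum>s\<in>cfgs d Y. diag_op K (\<lambda>k. complex_of_real (exp (- \<beta> * a k))) e s s)"
    unfolding mtr_def by (intro sum.cong refl E)
  also have "\<dots> = of_real (\<Sum>j\<in>K. exp (- \<beta> * a j))"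
    unfolding diag_op_trace[OF onb] by simp
  finally show ?thesis unfolding gibbs_def Let_def
    using E[OF s t] by (simp add: diag_op_def sum_divide_distrib)
qed

lemma orthonormal_basis_nonempty: "orthonormal_basis I K e \<Longrightarrow> I \<noteq> {} \<Longrightarrow> K \<noteq> {}"
  by (force simp: orthonormal_basis_def)

text \<open>All three facts hold because the Boltzmann weights \<open>p k\<close> form a probability
  vector in an eigenbasis of the Hamiltonian: they are real, nonnegative and sum to 1.\<close>

lemma gibbs_state:
  assumes I: "finite (cfgs d Y)" "cfgs d Y \<noteq> {}" and H: "hermitian d Y (ham d h Y)"
  shows hermitian_gibbs: "hermitian d Y (gibbs d h \<beta> Y)"
    and trace_gibbs: "mtr d Y (gibbs d h \<beta> Y) = 1"
    and contraction_trace_gibbs: "contraction (cfgs d Y) F \<Longrightarrow> cmod (mtr d Y (mmult d Y F (gibbs d h \<beta> Y))) \<le> 1"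
proof -
  let ?I = "cfgs d Y"
  obtain n :: nat and a :: "nat \<Rightarrow> real" and e where onb: "orthonormal_basis ?I {..<n} e"
    and Hd: "\<And>s t. s \<in> ?I \<Longrightarrow> t \<in> ?I \<Longrightarrow> ham d h Y s t = diag_op {..<n} (\<lambda>k. of_real (a k)) e s t"
    using spectral_theorem[OF I(1)] H unfolding hermitian_iff by metis
  define Z where "Z = (\<Sum>j<n. exp (- \<beta> * a j))"
  have Z: "Z > 0" unfolding Z_def
    using orthonormal_basis_nonempty[OF onb I(2)] by (intro sum_pos) auto
  define p where "p k = exp (- \<beta> * a k) / Z" for k
  have p1: "(\<Sum>k<n. p k) = 1" using Z by (simp add: p_def Z_def flip: sum_divide_distrib)
  have p0: "0 \<le> p k" for k using Z by (simp add: p_def)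
  have g: "gibbs d h \<beta> Y s t = diag_op {..<n} (\<lambda>k. complex_of_real (p k)) e s t" if "s \<in> ?I" "t \<in> ?I" for s t
    using gibbs_diag_op[OF onb Hd that] by (simp add: p_def Z_def)
  show "hermitian d Y (gibbs d h \<beta> Y)" unfolding hermitian_iff by (rule herm_on_diag_op[OF g])
  have "mtr d Y (gibbs d h \<beta> Y) = (\<Sum>s\<in>?I. diag_op {..<n} (\<lambda>k. complex_of_real (p k)) e s s)"
    unfolding mtr_def by (rule sum.cong) (auto simp: g)
  then show "mtr d Y (gibbs d h \<beta> Y) = 1"
    unfolding diag_op_trace[OF onb] by (simp add: p1 flip: of_real_sum)
  assume F: "contraction ?I F"
  have "mtr d Y (mmult d Y F (gibbs d h \<beta> Y)) = (\<Sum>s\<in>?I. \<Sum>t\<in>?I. F s t * diag_op {..<n} (\<lambda>k. of_real (p k)) e t s)"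
    unfolding mtr_mmult by (intro sum.cong refl) (simp add: g)
  then show "cmod (mtr d Y (mmult d Y F (gibbs d h \<beta> Y))) \<le> 1"
    using contraction_trace_diag_op[OF F onb, of "\<lambda>k. of_real (p k)"] p0 p1 by simp
qed

section \<open>Operators on tensor products of regions\<close>

lemma restrict_eq_iff: "restrict s S = restrict t S \<longleftrightarrow> (\<forall>x\<in>S. s x = t x)"
  by (auto simp: restrict_def fun_eq_iff)

lemma cfgs_eq_iff: "s \<in> cfgs d Y \<Longrightarrow> t \<in> cfgs d Y \<Longrightarrow> s = t \<longleftrightarrow> (\<forall>x\<in>Y. s x = t x)"
  unfolding cfgs_def by (auto intro: PiE_ext)

lemma finite_cfgs: "finite Y \<Longrightarrow> finite (cfgs d Y)"
  by (simp add: cfgs_def finite_PiE)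

lemma cfgs_nonempty: "(\<And>x. 1 \<le> d x) \<Longrightarrow> cfgs d Y \<noteq> {}"
  using not_less_eq_eq by (fastforce simp: cfgs_def PiE_eq_empty_iff lessThan_empty_iff)

lemma card_cfgs_singleton: "card (cfgs d {y}) = d y"
  by (simp add: cfgs_def card_PiE)

lemma restrict_cfgs: "s \<in> cfgs d Y \<Longrightarrow> Z \<subseteq> Y \<Longrightarrow> restrict s Z \<in> cfgs d Z"
  by (auto simp: cfgs_def)

lemma restrict_cfgs_id: "s \<in> cfgs d Y \<Longrightarrow> restrict s Y = s"
  by (auto simp: cfgs_def)

lemma restrict_merge_left: "Z \<inter> V = {} \<Longrightarrow> restrict (merge V v u) Z = restrict u Z"
  by (auto simp: merge_def restrict_def fun_eq_iff)

lemma restrict_merge_right: "Z \<subseteq> V \<Longrightarrow> restrict (merge V v u) Z = restrict v Z"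
  by (auto simp: merge_def restrict_def fun_eq_iff)

text \<open>The product basis of the tensor product of the spaces of \<open>U\<close> and
  \<open>V\<close>. Restriction to the two regions is the inverse map; disjointness keeps
  \<open>v\<close> from overwriting \<open>u\<close>.\<close>

lemma bij_betw_merge:
  assumes "U \<inter> V = {}"
  shows "bij_betw (\<lambda>(u, v). merge V v u) (cfgs d U \<times> cfgs d V) (cfgs d (U \<union> V))"
proof (rule bij_betw_byWitness[where f' = "\<lambda>s. (restrict s U, restrict s V)"])
  show "\<forall>p\<in>cfgs d U \<times> cfgs d V.
      (restrict ((\<lambda>(u, v). merge V v u) p) U, restrict ((\<lambda>(u, v). merge V v u) p) V) = p"
    using assms by (auto simp: restrict_merge_left restrict_merge_right restrict_cfgs_id)
  show "\<forall>s\<in>cfgs d (U \<union> V). (\<lambda>(u, v). merge V v u) (restrict s U, restrict s V) = s"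
    by (auto simp: merge_def fun_eq_iff cfgs_def PiE_def extensional_def)
  show "(\<lambda>(u, v). merge V v u) ` (cfgs d U \<times> cfgs d V) \<subseteq> cfgs d (U \<union> V)"
    using assms by (auto simp: merge_def cfgs_def PiE_def extensional_def Pi_def)
  show "(\<lambda>s. (restrict s U, restrict s V)) ` cfgs d (U \<union> V) \<subseteq> cfgs d U \<times> cfgs d V"
    by (auto intro: restrict_cfgs)
qed

lemma merge_in_cfgs:
  "U \<inter> V = {} \<Longrightarrow> u \<in> cfgs d U \<Longrightarrow> v \<in> cfgs d V \<Longrightarrow> merge V v u \<in> cfgs d (U \<union> V)"
  using bij_betw_apply[OF bij_betw_merge, of U V "(u, v)" d] by simp

lemma cfgs_Un_cases:
  assumes "U \<inter> V = {}" "s \<in> cfgs d (U \<union> V)"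
  obtains u v where "u \<in> cfgs d U" "v \<in> cfgs d V" "s = merge V v u"
proof -
  have "s \<in> (\<lambda>(u, v). merge V v u) ` (cfgs d U \<times> cfgs d V)"
    using bij_betw_imp_surj_on[OF bij_betw_merge[OF assms(1), of d]] assms(2) by simp
  then show thesis using that by auto
qed

lemma sum_cfgs_Un:
  assumes "U \<inter> V = {}"
  shows "(\<Sum>s\<in>cfgs d (U \<union> V). g s) = (\<Sum>u\<in>cfgs d U. \<Sum>v\<in>cfgs d V. g (merge V v u))"
  unfolding sum.cartesian_product
  using sum.reindex_bij_betw[OF bij_betw_merge[OF assms, of d], of g] by (simp add: case_prod_unfold)

lemma merge_eq_iff:
  assumes "U \<inter> V = {}" "u \<in> cfgs d U" "u' \<in> cfgs d U" "v \<in> cfgs d V" "v' \<in> cfgs d V"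
  shows "merge V v u = merge V v' u' \<longleftrightarrow> u = u' \<and> v = v'"
  using inj_onD[OF bij_betw_imp_inj_on[OF bij_betw_merge[OF assms(1), of d]], of "(u, v)" "(u', v')"] assms
  by auto

text \<open>In the tensor factorisation the extension acts as the identity on \<open>V\<close>:
  agreement outside \<open>Z\<close> splits into agreement on \<open>V\<close> and agreement on
  \<open>U - Z\<close>.\<close>

lemma ext_op_merge_left:
  assumes UV: "U \<inter> V = {}" and Z: "Z \<subseteq> U"
    and c: "u \<in> cfgs d U" "u' \<in> cfgs d U" "v \<in> cfgs d V" "v' \<in> cfgs d V"
  shows "ext_op Z (U \<union> V) M (merge V v u) (merge V v' u') = of_bool (v = v') * ext_op Z U M u u'"
proof -
  have "Z \<inter> V = {}" using UV Z by auto
  moreover have "(\<forall>x\<in>U \<union> V - Z. merge V v u x = merge V v' u' x) \<longleftrightarrow> v = v' \<and> (\<forall>x\<in>U - Z. u x = u' x)"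
  proof -
    have "U \<union> V - Z = V \<union> (U - Z)" using UV Z by auto
    then show ?thesis unfolding cfgs_eq_iff[OF c(3,4)] 
      by (simp only: ball_Un, intro arg_cong2[where f = "(\<and>)"] ball_cong refl)
        (use UV in \<open>auto simp: merge_def\<close>)
  qed
  ultimately show ?thesis by (auto simp: ext_op_def restrict_eq_iff restrict_merge_left)
qed

lemma ext_op_merge_right:
  assumes UV: "U \<inter> V = {}" and Z: "Z \<subseteq> V"
    and c: "u \<in> cfgs d U" "u' \<in> cfgs d U" "v \<in> cfgs d V" "v' \<in> cfgs d V"
  shows "ext_op Z (U \<union> V) M (merge V v u) (merge V v' u') = of_bool (u = u') * ext_op Z V M v v'"
proof -
  have "(\<forall>x\<in>U \<union> V - Z. merge V v u x = merge V v' u' x) \<longleftrightarrow> u = u' \<and> (\<forall>x\<in>V - Z. v x = v' x)"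
  proof -
    have "U \<union> V - Z = U \<union> (V - Z)" using UV Z by auto
    then show ?thesis unfolding cfgs_eq_iff[OF c(1,2)] 
      by (simp only: ball_Un, intro arg_cong2[where f = "(\<and>)"] ball_cong refl)
        (use UV in \<open>auto simp: merge_def\<close>)
  qed
  then show ?thesis using Z by (auto simp: ext_op_def restrict_eq_iff restrict_merge_right)
qed

lemma ext_op_self: "s \<in> cfgs d Y \<Longrightarrow> t \<in> cfgs d Y \<Longrightarrow> ext_op Y Y M s t = M s t"
  by (simp add: ext_op_def restrict_cfgs_id restrict_eq_iff)

text \<open>Operators are total functions whose entries are meaningful only at configurations of
  \<open>Y\<close>, so operator identities are stated on that block only.\<close>

definition op_eq :: "('d site \<Rightarrow> nat) \<Rightarrow> 'd site set \<Rightarrow> 'd op \<Rightarrow> 'd op \<Rightarrow> bool" where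
  "op_eq d Y M N \<longleftrightarrow> (\<forall>s\<in>cfgs d Y. \<forall>t\<in>cfgs d Y. M s t = N s t)"

lemma op_eq_refl: "op_eq d Y M M" by (simp add: op_eq_def)

lemma op_eq_trans [trans]: "op_eq d Y M N \<Longrightarrow> op_eq d Y N P \<Longrightarrow> op_eq d Y M P" by (simp add: op_eq_def)

lemma op_eq_mmult: "op_eq d Y M M' \<Longrightarrow> op_eq d Y N N' \<Longrightarrow> op_eq d Y (mmult d Y M N) (mmult d Y M' N')"
  unfolding op_eq_def mmult_def by (intro ballI sum.cong) auto

lemma op_eq_mtr: "op_eq d Y M N \<Longrightarrow> mtr d Y M = mtr d Y N"
  unfolding op_eq_def mtr_def by (intro sum.cong) auto

lemma mmult_assoc: "mmult d Y (mmult d Y M N) P = mmult d Y M (mmult d Y N P)"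
  unfolding mmult_def sum_distrib_left sum_distrib_right fun_eq_iff
  by (intro allI, subst sum.swap) (simp add: mult_ac)

lemma mtr_commute: "mtr d Y (mmult d Y M N) = mtr d Y (mmult d Y N M)"
  unfolding mtr_mmult by (subst sum.swap) (simp add: mult_ac)

lemma madj_mmult: "madj (mmult d Y M N) = mmult d Y (madj N) (madj M)"
  by (simp add: madj_def mmult_def fun_eq_iff mult_ac)

lemma madj_madj: "madj (madj M) = M"
  by (simp add: madj_def)

lemma hermitian_iff_op_eq: "hermitian d Y M \<longleftrightarrow> op_eq d Y M (madj M)"
  by (simp add: hermitian_def op_eq_def madj_def)

lemma hermitian_conj:
  assumes "hermitian d Y R"
  shows "hermitian d Y (mmult d Y (mmult d Y E R) (madj E))"
  unfolding hermitian_iff_op_eq madj_mmult madj_madj mmult_assoc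
  using assms unfolding hermitian_iff_op_eq by (intro op_eq_mmult op_eq_refl)

lemma hermitian_madj_mult: "hermitian d Y (mmult d Y (madj E) E)"
  unfolding hermitian_iff_op_eq madj_mmult madj_madj by (rule op_eq_refl)

lemma hermitian_msub: "hermitian d Y M \<Longrightarrow> hermitian d Y N \<Longrightarrow> hermitian d Y (msub M N)"
  unfolding hermitian_def msub_def complex_cnj_diff by metis

lemma mtr_mmult_msub:
  "mtr d Y (mmult d Y F (msub M N)) = mtr d Y (mmult d Y F M) - mtr d Y (mmult d Y F N)"
  by (simp add: mtr_mmult msub_def right_diff_distrib sum_subtractf)

lemma madj_ext_op: "madj (ext_op Z Y M) = ext_op Z Y (madj M)"
  by (auto simp: madj_def ext_op_def fun_eq_iff)

lemma hermitian_ext_op: "hermitian d Z M \<Longrightarrow> Z \<subseteq> Y \<Longrightarrow> hermitian d Y (ext_op Z Y M)"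
  unfolding hermitian_iff_op_eq madj_ext_op
  by (auto simp: op_eq_def ext_op_def restrict_cfgs)

lemma hermitian_ham:
  assumes "\<And>Z. Z \<subseteq> Y \<Longrightarrow> hermitian d Z (h Z)"
  shows "hermitian d Y (ham d h Y)"
  unfolding hermitian_def ham_def cnj_sum
proof (intro ballI sum.cong refl)
  fix s t Z assume "s \<in> cfgs d Y" "t \<in> cfgs d Y" "Z \<in> Pow Y"
  then show "ext_op Z Y (h Z) s t = cnj (ext_op Z Y (h Z) t s)"
    using hermitian_ext_op[OF assms, of Z Y] unfolding hermitian_def by blast
qed

text \<open>Clustering speaks of observables given on a subregion, so \<open>madj E\<close> times
  \<open>E\<close> has to be recognised as the extension of a single operator on the ball.\<close>

lemma ext_op_mmult:
  assumes Z: "Z \<subseteq> Y" and f: "finite Y"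
  shows "op_eq d Y (mmult d Y (ext_op Z Y M) (ext_op Z Y N)) (ext_op Z Y (mmult d Z M N))"
proof -
  define V where "V = Y - Z"
  have Y: "Y = Z \<union> V" and ZV: "Z \<inter> V = {}" using Z by (auto simp: V_def)
  have fin: "finite (cfgs d V)" using f by (simp add: V_def finite_cfgs)
  show ?thesis unfolding op_eq_def
  proof (intro ballI)
    fix s t assume "s \<in> cfgs d Y" "t \<in> cfgs d Y"
    then obtain u v u' v' where c: "u \<in> cfgs d Z" "v \<in> cfgs d V" "u' \<in> cfgs d Z" "v' \<in> cfgs d V"
      and st: "s = merge V v u" "t = merge V v' u'"
      unfolding Y using cfgs_Un_cases[OF ZV] by metis
    have "mmult d Y (ext_op Z Y M) (ext_op Z Y N) s t
        = (\<Sum>a\<in>cfgs d Z. \<Sum>w\<in>cfgs d V. of_bool (v = w) * M u a * (of_bool (w = v') * N a u'))"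
      unfolding mmult_def Y sum_cfgs_Un[OF ZV] st
      by (intro sum.cong refl) (simp add: ext_op_merge_left[OF ZV order.refl, where d = d] c ext_op_self[where d = d])
    also have "\<dots> = (\<Sum>a\<in>cfgs d Z. \<Sum>w\<in>cfgs d V. if v = w then M u a * (of_bool (w = v') * N a u') else 0)"
      by (intro sum.cong refl) auto
    also have "\<dots> = of_bool (v = v') * (\<Sum>a\<in>cfgs d Z. M u a * N a u')"
      using fin c by (simp add: sum_distrib_left mult_ac)
    also have "\<dots> = ext_op Z Y (mmult d Z M N) s t"
      unfolding Y st by (simp add: ext_op_merge_left[OF ZV order.refl, where d = d] c ext_op_self[OF c(1,3)] mmult_def)
    finally show "mmult d Y (ext_op Z Y M) (ext_op Z Y N) s t = ext_op Z Y (mmult d Z M N) s t" .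
  qed
qed

text \<open>With \<open>Y\<close> split into \<open>A\<close> and its complement \<open>V\<close>,
  which contains \<open>Z\<close>, both products are the tensor product of \<open>M\<close> with the
  extension of \<open>N\<close> to \<open>V\<close>.\<close>

lemma ext_op_commute:
  assumes A: "A \<subseteq> Y" and Z: "Z \<subseteq> Y" and AZ: "A \<inter> Z = {}" and f: "finite Y"
  shows "op_eq d Y (mmult d Y (ext_op A Y M) (ext_op Z Y N)) (mmult d Y (ext_op Z Y N) (ext_op A Y M))"
proof -
  define V where "V = Y - A"
  have Y: "Y = A \<union> V" and AV: "A \<inter> V = {}" and ZV: "Z \<subseteq> V" using A Z AZ by (auto simp: V_def)
  have "finite V" "finite A" using f Y by auto
  then have fin: "finite (cfgs d V)" "finite (cfgs d A)" by (simp_all add: finite_cfgs)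
  show ?thesis unfolding op_eq_def
  proof (intro ballI)
    fix s t assume "s \<in> cfgs d Y" "t \<in> cfgs d Y"
    then obtain u v u' v' where c: "u \<in> cfgs d A" "v \<in> cfgs d V" "u' \<in> cfgs d A" "v' \<in> cfgs d V"
      and st: "s = merge V v u" "t = merge V v' u'"
      unfolding Y using cfgs_Un_cases[OF AV] by metis
    have "mmult d Y (ext_op A Y M) (ext_op Z Y N) s t
        = (\<Sum>a\<in>cfgs d A. \<Sum>w\<in>cfgs d V. of_bool (v = w) * M u a * (of_bool (a = u') * ext_op Z V N w v'))"
      unfolding mmult_def Y sum_cfgs_Un[OF AV] st
      by (intro sum.cong refl)
        (simp add: ext_op_merge_left[OF AV order.refl, where d = d] ext_op_merge_right[OF AV ZV, where d = d] c ext_op_self[where d = d])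
    also have "\<dots> = (\<Sum>a\<in>cfgs d A. \<Sum>w\<in>cfgs d V.
        if v = w then if a = u' then M u a * ext_op Z V N w v' else 0 else 0)"
      by (intro sum.cong refl) auto
    also have "\<dots> = M u u' * ext_op Z V N v v'"
      using fin c by simp
    finally have 1: "mmult d Y (ext_op A Y M) (ext_op Z Y N) s t = M u u' * ext_op Z V N v v'" .
    have "mmult d Y (ext_op Z Y N) (ext_op A Y M) s t
        = (\<Sum>a\<in>cfgs d A. \<Sum>w\<in>cfgs d V. of_bool (u = a) * ext_op Z V N v w * (of_bool (w = v') * M a u'))"
      unfolding mmult_def Y sum_cfgs_Un[OF AV] st
      by (intro sum.cong refl)
        (simp add: ext_op_merge_left[OF AV order.refl, where d = d] ext_op_merge_right[OF AV ZV, where d = d] c ext_op_self[where d = d])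
    also have "\<dots> = (\<Sum>a\<in>cfgs d A. \<Sum>w\<in>cfgs d V.
        if w = v' then if u = a then M a u' * ext_op Z V N v w else 0 else 0)"
      by (intro sum.cong refl) auto
    also have "\<dots> = M u u' * ext_op Z V N v v'"
      using fin c by simp
    finally show "mmult d Y (ext_op A Y M) (ext_op Z Y N) s t = mmult d Y (ext_op Z Y N) (ext_op A Y M) s t"
      using 1 by simp
  qed
qed

text \<open>The defining duality of the partial trace; it turns expectations in reduced states into
  expectations in states of the whole region.\<close>

lemma mtr_ext_op_ptr:
  assumes AW: "A \<inter> W = {}" and f: "finite W"
  shows "mtr d (A \<union> W) (mmult d (A \<union> W) (ext_op A (A \<union> W) F) R) = mtr d A (mmult d A F (ptr d W R))"
proof -
  have fin: "finite (cfgs d W)" using f by (simp add: finite_cfgs)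
  have "mtr d (A \<union> W) (mmult d (A \<union> W) (ext_op A (A \<union> W) F) R)
      = (\<Sum>a\<in>cfgs d A. \<Sum>w\<in>cfgs d W. \<Sum>a'\<in>cfgs d A. \<Sum>w'\<in>cfgs d W.
          if w = w' then F a a' * R (merge W w' a') (merge W w a) else 0)"
    unfolding mtr_mmult sum_cfgs_Un[OF AW]
    by (intro sum.cong refl) (simp add: ext_op_merge_left[OF AW order.refl, where d = d] ext_op_self[where d = d])
  also have "\<dots> = (\<Sum>a\<in>cfgs d A. \<Sum>w\<in>cfgs d W. \<Sum>a'\<in>cfgs d A. F a a' * R (merge W w a') (merge W w a))"
    using fin by simp
  also have "\<dots> = (\<Sum>a\<in>cfgs d A. \<Sum>a'\<in>cfgs d A. \<Sum>w\<in>cfgs d W. F a a' * R (merge W w a') (merge W w a))"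
    by (intro sum.cong refl sum.swap)
  finally show ?thesis by (simp add: mtr_mmult ptr_def sum_distrib_left)
qed

text \<open>Used for two product states: the maximally mixed factor at a removed site, and the
  decoupled remainder of \<open>C\<close>.\<close>

lemma mtr_ext_op_product:
  assumes UV: "U \<inter> V = {}" and A: "A \<subseteq> U" and f: "finite V"
    and R: "\<And>u u' v v'. u \<in> cfgs d U \<Longrightarrow> u' \<in> cfgs d U \<Longrightarrow> v \<in> cfgs d V \<Longrightarrow> v' \<in> cfgs d V \<Longrightarrow>
      R (merge V v u) (merge V v' u') = R1 u u' * R2 v v'"
  shows "mtr d (U \<union> V) (mmult d (U \<union> V) (ext_op A (U \<union> V) F) R)
    = mtr d U (mmult d U (ext_op A U F) R1) * mtr d V R2"
proof -
  have fin: "finite (cfgs d V)" using f by (simp add: finite_cfgs)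
  have "mtr d (U \<union> V) (mmult d (U \<union> V) (ext_op A (U \<union> V) F) R)
      = (\<Sum>u\<in>cfgs d U. \<Sum>v\<in>cfgs d V. \<Sum>u'\<in>cfgs d U. \<Sum>v'\<in>cfgs d V.
          if v = v' then ext_op A U F u u' * R1 u' u * R2 v' v else 0)"
    unfolding mtr_mmult sum_cfgs_Un[OF UV]
    by (intro sum.cong refl) (simp add: ext_op_merge_left[OF UV A, where d = d] R)
  also have "\<dots> = (\<Sum>u\<in>cfgs d U. \<Sum>v\<in>cfgs d V. (\<Sum>u'\<in>cfgs d U. ext_op A U F u u' * R1 u' u) * R2 v v)"
    using fin by (simp add: sum_distrib_right)
  finally show ?thesis unfolding mtr_mmult mtr_def[of d V] sum_product .
qed

text \<open>The vector is cut into slices, one for each configuration of the complement. The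
  extension acts on every slice by \<open>F\<close>, and squared norms add over slices.\<close>

lemma contraction_ext_op:
  assumes A: "A \<subseteq> Y" and f: "finite Y" and F: "contraction (cfgs d A) F"
  shows "contraction (cfgs d Y) (ext_op A Y F)"
  unfolding contraction_def
proof
  fix v
  define W where "W = Y - A"
  have Y: "Y = A \<union> W" and AW: "A \<inter> W = {}" using A by (auto simp: W_def)
  have fin: "finite (cfgs d W)" using f by (simp add: W_def finite_cfgs)
  have slice: "nsq (cfgs d Y) x = (\<Sum>w\<in>cfgs d W. nsq (cfgs d A) (\<lambda>a. x (merge W w a)))" for x
    unfolding nsq_def Y sum_cfgs_Un[OF AW] by (rule sum.swap)
  have mv: "mvec (cfgs d Y) (ext_op A Y F) v (merge W w a) = mvec (cfgs d A) F (\<lambda>a. v (merge W w a)) a"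
    if "a \<in> cfgs d A" "w \<in> cfgs d W" for a w
  proof -
    have "mvec (cfgs d Y) (ext_op A Y F) v (merge W w a)
        = (\<Sum>a'\<in>cfgs d A. \<Sum>w'\<in>cfgs d W. if w = w' then F a a' * v (merge W w' a') else 0)"
      unfolding mvec_def Y sum_cfgs_Un[OF AW]
      by (intro sum.cong refl) (simp add: ext_op_merge_left[OF AW order.refl, where d = d] ext_op_self[where d = d] that)
    then show ?thesis using fin that by (simp add: mvec_def)
  qed
  have "nsq (cfgs d Y) (mvec (cfgs d Y) (ext_op A Y F) v)
      = (\<Sum>w\<in>cfgs d W. nsq (cfgs d A) (mvec (cfgs d A) F (\<lambda>a. v (merge W w a))))"
    unfolding slice by (intro sum.cong nsq_cong) (simp_all add: mv)
  also have "\<dots> \<le> (\<Sum>w\<in>cfgs d W. nsq (cfgs d A) (\<lambda>a. v (merge W w a)))"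
    using F by (intro sum_mono) (simp add: contraction_def)
  finally show "nsq (cfgs d Y) (mvec (cfgs d Y) (ext_op A Y F) v) \<le> nsq (cfgs d Y) v"
    unfolding slice[of v] .
qed

section \<open>Removing the boundary of the shielded region\<close>

lemma hermitian_ptr:
  assumes R: "hermitian d (A \<union> W) R" and AW: "A \<inter> W = {}"
  shows "hermitian d A (ptr d W R)"
  unfolding hermitian_def ptr_def cnj_sum
proof (intro ballI sum.cong refl)
  fix s t u assume "s \<in> cfgs d A" "t \<in> cfgs d A" "u \<in> cfgs d W"
  then show "R (merge W u s) (merge W u t) = cnj (R (merge W u t) (merge W u s))"
    using R merge_in_cfgs[OF AW] unfolding hermitian_def by blast
qed

lemma mmult_mone_left: "finite (cfgs d Y) \<Longrightarrow> op_eq d Y (mmult d Y mone M) M"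
  by (simp add: op_eq_def mmult_def mone_def if_distrib[of "\<lambda>x. x * _"] cong: if_cong)

lemma ext_op_mone: "A \<subseteq> Y \<Longrightarrow> op_eq d Y (ext_op A Y mone) mone"
  unfolding op_eq_def ext_op_def mone_def by (auto simp: restrict_eq_iff cfgs_eq_iff)

lemma mvec_mone: "finite I \<Longrightarrow> s \<in> I \<Longrightarrow> mvec I mone v s = v s"
  by (simp add: mvec_def mone_def if_distrib[of "\<lambda>x. x * _"] cong: if_cong)

lemma nsq_mone: "finite I \<Longrightarrow> nsq I (mvec I mone v) = nsq I v"
  by (rule nsq_cong) (rule mvec_mone)

lemma opnorm_mone:
  assumes "finite (cfgs d Y)" "cfgs d Y \<noteq> {}"
  shows "opnorm d Y mone = 1"
proof -
  have "{sqrt (nsq (cfgs d Y) (mvec (cfgs d Y) mone v)) | v. nsq (cfgs d Y) v = 1} = {1}"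
    using ex_unit_vector[OF assms] by (auto simp: nsq_mone[OF assms(1)])
  then show ?thesis by (simp add: opnorm_eq)
qed

text \<open>Clustering is tested on identities over the empty region: the distance condition is
  vacuous, both norms are 1, and a covariance is nonnegative.\<close>

lemma uniformly_clustering_nonneg:
  assumes "uniformly_clustering d h \<beta> \<Lambda> \<epsilon>"
  shows "0 \<le> \<epsilon> l"
proof -
  have "cfgs d {} \<noteq> {}" "finite (cfgs d {})" by (simp_all add: cfgs_def)
  then have 1: "opnorm d {} mone = 1" by (intro opnorm_mone)
  have "hermitian d {} mone" by (simp add: hermitian_def mone_def)
  then have "cov d {} (gibbs d h \<beta> {}) (ext_op {} {} mone) (ext_op {} {} mone) \<le> 1 * 1 * \<epsilon> l"
    using assms unfolding uniformly_clustering_def 1[symmetric] by blast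
  moreover have "0 \<le> cov d {} (gibbs d h \<beta> {}) (ext_op {} {} mone) (ext_op {} {} mone)"
    by (simp add: cov_def)
  ultimately show ?thesis by simp
qed

text \<open>Kept general in \<open>F\<close>, since it is applied both to the test observable and to
  the identity.\<close>

lemma site_removal_expectation:
  assumes f: "finite Y" and y: "y \<in> Y" "1 \<le> d y" and A: "A \<subseteq> Y" "y \<notin> A" and B: "B \<subseteq> Y" "A \<inter> B = {}"
    and R: "hermitian d Y R" and R': "hermitian d (Y - {y}) R'" and F: "contraction (cfgs d A) F"
    and tn: "tnorm d Y (msub (\<lambda>s t. ext_op (Y - {y}) Y R' s t / of_nat (d y))
        (mmult d Y (mmult d Y (ext_op B Y \<eta>) R) (madj (ext_op B Y \<eta>)))) \<le> \<gamma>"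
  shows "cmod (mtr d (Y - {y}) (mmult d (Y - {y}) (ext_op A (Y - {y}) F) R')
    - mtr d Y (mmult d Y R (mmult d Y (ext_op A Y F) (ext_op B Y (mmult d B (madj \<eta>) \<eta>))))) \<le> \<gamma>"
proof -
  define U where "U = Y - {y}"
  have Y: "Y = U \<union> {y}" and Uy: "U \<inter> {y} = {}" and AU: "A \<subseteq> U" using y A by (auto simp: U_def)
  let ?E = "ext_op B Y \<eta>" and ?F = "ext_op A Y F"
  let ?P = "\<lambda>s t. ext_op U Y R' s t / of_nat (d y)"
  let ?Q = "mmult d Y (mmult d Y ?E R) (madj ?E)"
  have fin: "finite (cfgs d Y)" using f by (rule finite_cfgs)
  have hP: "hermitian d Y ?P"
  proof -
    have "hermitian d Y (ext_op U Y R')" using R' by (intro hermitian_ext_op) (auto simp: U_def)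
    then show ?thesis unfolding hermitian_def complex_cnj_divide complex_cnj_of_nat by metis
  qed
  have "cmod (mtr d Y (mmult d Y ?F (msub ?P ?Q))) \<le> tnorm d Y (msub ?P ?Q)"
    using fin by (rule trace_le_tnorm) (intro hermitian_msub hP hermitian_conj R contraction_ext_op[OF A(1) f F])+
  also have "\<dots> \<le> \<gamma>" using tn by (simp add: U_def)
  finally have *: "cmod (mtr d Y (mmult d Y ?F ?P) - mtr d Y (mmult d Y ?F ?Q)) \<le> \<gamma>"
    by (simp add: mtr_mmult_msub)
  \<comment> \<open>The factor at \<open>y\<close> is maximally mixed with trace 1, so padding
    \<open>R'\<close> by it leaves the expectation of \<open>F\<close> unchanged.\<close>
  have "mtr d {y} (\<lambda>v v'. of_bool (v = v') / of_nat (d y)) = 1"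
    using y by (simp add: mtr_def card_cfgs_singleton)
  moreover have "mtr d (U \<union> {y}) (mmult d (U \<union> {y}) (ext_op A (U \<union> {y}) F) (\<lambda>s t. ext_op U (U \<union> {y}) R' s t / of_nat (d y)))
      = mtr d U (mmult d U (ext_op A U F) R') * mtr d {y} (\<lambda>v v'. of_bool (v = v') / of_nat (d y))"
    by (rule mtr_ext_op_product[OF Uy AU])
      (simp_all add: ext_op_merge_left[OF Uy order.refl, where d = d] ext_op_self[where d = d]
        del: Un_insert_right)
  ultimately have P: "mtr d Y (mmult d Y ?F ?P) = mtr d U (mmult d U (ext_op A U F) R')"
    unfolding Y[symmetric] by simp
  have "mtr d Y (mmult d Y ?F ?Q) = mtr d Y (mmult d Y (mmult d Y ?F ?E) (mmult d Y R (madj ?E)))"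
    by (simp add: mmult_assoc)
  \<comment> \<open>Cyclicity puts \<open>R\<close> in front and \<open>madj ?E\<close> to the left
    of \<open>?F\<close>; disjoint supports then let it pass to the right.\<close>
  also have "\<dots> = mtr d Y (mmult d Y R (mmult d Y (mmult d Y (madj ?E) ?F) ?E))"
    by (subst mtr_commute) (simp add: mmult_assoc)
  also have "\<dots> = mtr d Y (mmult d Y R (mmult d Y ?F (mmult d Y (madj ?E) ?E)))"
    unfolding mmult_assoc[of d Y ?F, symmetric] madj_ext_op
    by (intro op_eq_mtr op_eq_mmult op_eq_refl ext_op_commute) (use A B f in auto)
  also have "\<dots> = mtr d Y (mmult d Y R (mmult d Y ?F (ext_op B Y (mmult d B (madj \<eta>) \<eta>))))"
    unfolding madj_ext_op
    by (intro op_eq_mtr op_eq_mmult op_eq_refl ext_op_mmult) (use B f in auto)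
  finally show ?thesis using * unfolding P by (simp add: U_def)
qed

lemma ldist_triangle: "ldist x z \<le> ldist x y + ldist y z"
  unfolding ldist_def by (rule dist_triangle)

text \<open>The three errors are the belief propagation error for \<open>F\<close>, the clustering
  error, and the belief propagation error for the identity, which measures how far conjugation by
  the extension of \<eta> is from preserving the trace.\<close>

lemma site_removal:
  assumes f: "finite \<Lambda>" and Y: "Y \<subseteq> \<Lambda>" and y: "y \<in> Y" and A: "A \<subseteq> Y" and d: "\<And>x. 1 \<le> d x"
    and h: "\<And>Z. finite Z \<Longrightarrow> hermitian d Z (h Z)"
    and cl: "uniformly_clustering d h \<beta> \<Lambda> \<epsilon>" and bp: "bp_error d h \<beta> \<Lambda> c1 c2 M"
    and l: "0 < l" "\<And>a. a \<in> A \<Longrightarrow> l \<le> ldist a y"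
    and F: "hermitian d A F" "contraction (cfgs d A) F"
  shows "cmod (mtr d Y (mmult d Y (ext_op A Y F) (gibbs d h \<beta> Y))
      - mtr d (Y - {y}) (mmult d (Y - {y}) (ext_op A (Y - {y}) F) (gibbs d h \<beta> (Y - {y}))))
    \<le> \<bar>M\<bar> * \<epsilon> (l / 2) + 2 * (c1 * exp (- c2 * (l / 2)))"
proof -
  let ?\<gamma> = "c1 * exp (- c2 * (l / 2))"
  \<comment> \<open>Halving the radius leaves distance at least \<open>l / 2\<close> between
    \<open>A\<close> and the ball, by the triangle inequality.\<close>
  define B where "B = {z\<in>Y. ldist z y \<le> l / 2}"
  define R where "R = gibbs d h \<beta> Y"
  define R' where "R' = gibbs d h \<beta> (Y - {y})"
  have fY: "finite Y" using f Y by (rule rev_finite_subset)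
  have fc: "finite (cfgs d Z)" "cfgs d Z \<noteq> {}" if "Z \<subseteq> Y" for Z
    using finite_cfgs[of Z d] cfgs_nonempty[of d, OF d] finite_subset[OF that fY] by auto
  have hH: "hermitian d Z (ham d h Z)" if "Z \<subseteq> Y" for Z
    using h that fY by (meson hermitian_ham finite_subset)
  note gY = gibbs_state[OF fc[OF order.refl] hH[OF order.refl], where \<beta> = \<beta>, folded R_def]
  have "Y - {y} \<subseteq> Y" by auto
  note gY' = gibbs_state[OF fc[OF this] hH[OF this], where \<beta> = \<beta>, folded R'_def]
  obtain \<eta> where M: "opnorm d B (mmult d B (madj \<eta>) \<eta>) \<le> M" and
      tn: "tnorm d Y (msub (\<lambda>s t. ext_op (Y - {y}) Y R' s t / of_nat (d y))
        (mmult d Y (mmult d Y (ext_op B Y \<eta>) R) (madj (ext_op B Y \<eta>)))) \<le> ?\<gamma>"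
    using bp[unfolded bp_error_def Let_def, rule_format, of Y y "l / 2"] Y y l
    unfolding B_def R_def R'_def by auto
  let ?g = "mmult d B (madj \<eta>) \<eta>"
  let ?G = "ext_op B Y ?g" and ?F = "ext_op A Y F"
  have far: "l / 2 \<le> ldist a b" if "a \<in> A" "b \<in> B" for a b
    using ldist_triangle[of a y b] l(2)[OF that(1)] that(2) by (simp add: B_def)
  have yA: "y \<notin> A" using l by (force simp: ldist_def)
  have AB: "A \<inter> B = {}" using l(1,2) by (force simp: B_def)
  have BY: "B \<subseteq> Y" by (auto simp: B_def)
  note rem = site_removal_expectation[OF fY y d A yA BY AB gY(1) gY'(1) _ tn]
  have 1: "cmod (mtr d (Y - {y}) (mmult d (Y - {y}) (ext_op A (Y - {y}) F) R') - mtr d Y (mmult d Y R (mmult d Y ?F ?G))) \<le> ?\<gamma>"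
    by (rule rem[OF F(2)])
  \<comment> \<open>The removal estimate with the identity as observable; the Gibbs state after
    removal has trace 1.\<close>
  have 2: "cmod (1 - mtr d Y (mmult d Y R ?G)) \<le> ?\<gamma>"
  proof -
    have "contraction (cfgs d A) mone" by (simp add: contraction_def nsq_mone[OF fc(1)[OF A]])
    from rem[OF this]
    have "cmod (mtr d (Y - {y}) (mmult d (Y - {y}) (ext_op A (Y - {y}) mone) R') - mtr d Y (mmult d Y R (mmult d Y (ext_op A Y mone) ?G))) \<le> ?\<gamma>" .
    moreover have a: "op_eq d (Y - {y}) (mmult d (Y - {y}) (ext_op A (Y - {y}) mone) R') R'"
      by (rule op_eq_trans[OF op_eq_mmult[OF ext_op_mone op_eq_refl] mmult_mone_left]) (use A yA fc(1) in auto)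
    moreover have b: "op_eq d Y (mmult d Y (ext_op A Y mone) ?G) ?G"
      by (rule op_eq_trans[OF op_eq_mmult[OF ext_op_mone op_eq_refl] mmult_mone_left]) (use A fc(1) in auto)
    ultimately show ?thesis
      unfolding op_eq_mtr[OF a] op_eq_mtr[OF op_eq_mmult[OF op_eq_refl b]] gY'(2) by simp
  qed
  have 3: "cmod (mtr d Y (mmult d Y R (mmult d Y ?F ?G)) - mtr d Y (mmult d Y R ?F) * mtr d Y (mmult d Y R ?G))
      \<le> \<bar>M\<bar> * \<epsilon> (l / 2)"
  proof -
    have "cov d Y R ?F ?G \<le> opnorm d A F * opnorm d B ?g * \<epsilon> (l / 2)"
      using cl[unfolded uniformly_clustering_def, rule_format, of Y A B "l / 2" F ?g]
        Y A BY far F(1) hermitian_madj_mult unfolding R_def by blast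
    \<comment> \<open>The modulus makes the bound nonnegative whatever the sign of \<open>M\<close>;
      the final constant relies on this.\<close>
    also have "\<dots> \<le> 1 * \<bar>M\<bar> * \<epsilon> (l / 2)"
      using M opnorm_le_1[OF fc[OF A] F(2)] opnorm_nonneg[OF fc[OF A], of F] opnorm_nonneg[OF fc[OF BY], of ?g]
      by (intro mult_right_mono mult_mono uniformly_clustering_nonneg[OF cl]) auto
    finally show ?thesis by (simp add: cov_def)
  qed
  have 4: "cmod (mtr d Y (mmult d Y R ?F)) \<le> 1"
    unfolding mtr_commute[of d Y R] by (rule gY(3)[OF contraction_ext_op[OF A fY F(2)]])
  have 5: "cmod (mtr d Y (mmult d Y R ?F) - mtr d Y (mmult d Y R ?F) * mtr d Y (mmult d Y R ?G)) \<le> ?\<gamma>"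
  proof -
    have "cmod (mtr d Y (mmult d Y R ?F) * (1 - mtr d Y (mmult d Y R ?G))) \<le> 1 * ?\<gamma>"
      unfolding norm_mult using 2 4 by (intro mult_mono) auto
    then show ?thesis by (simp add: right_diff_distrib)
  qed
  \<comment> \<open>The chain leads from the expectation of \<open>?F\<close> in \<open>R\<close>
    over its product with that of \<open>?G\<close>, then over the expectation of the operator
    product, to the expectation of \<open>F\<close> in \<open>R'\<close>.\<close>
  have tri: "cmod (p - q) \<le> e1 + (e2 + e3)" if "cmod (p - x) \<le> e1" "cmod (w - x) \<le> e2" "cmod (q - w) \<le> e3" for p q w x e1 e2 e3
    using norm_triangle_ineq4[of "p - x" "q - x"] norm_triangle_ineq[of "q - w" "w - x"] that
    by (simp add: algebra_simps)
  from tri[OF 5 3 1] show ?thesis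
    unfolding mtr_commute[of d Y ?F] R_def[symmetric] R'_def[symmetric] by simp
qed

section \<open>Factorisation of Gibbs states over decoupled regions\<close>

lemma orthonormal_basis_tensor:
  fixes e :: "'j \<Rightarrow> 'd cfg \<Rightarrow> complex" and g :: "'k \<Rightarrow> 'd cfg \<Rightarrow> complex"
  assumes UV: "U \<inter> V = {}" and e: "orthonormal_basis (cfgs d U) J e" and g: "orthonormal_basis (cfgs d V) K g"
    and fin: "finite (cfgs d (U \<union> V))"
    and E: "\<forall>j k. \<forall>u\<in>cfgs d U. \<forall>v\<in>cfgs d V. E (j, k) (merge V v u) = e j u * g k v"
  shows "orthonormal_basis (cfgs d (U \<union> V)) (J \<times> K) E"
    and "u \<in> cfgs d U \<Longrightarrow> u' \<in> cfgs d U \<Longrightarrow> v \<in> cfgs d V \<Longrightarrow> v' \<in> cfgs d V \<Longrightarrow>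
      diag_op (J \<times> K) (\<lambda>(j, k). a j * b k) E (merge V v u) (merge V v' u') = diag_op J a e u u' * diag_op K b g v v'"
proof -
  show diag: "diag_op (J \<times> K) (\<lambda>(j, k). a j * b k) E (merge V v u) (merge V v' u') = diag_op J a e u u' * diag_op K b g v v'"
    if "u \<in> cfgs d U" "u' \<in> cfgs d U" "v \<in> cfgs d V" "v' \<in> cfgs d V" for u u' v v' a b
    unfolding diag_op_def sum_product sum.cartesian_product
    by (intro sum.cong refl) (auto simp: E that mult_ac)
  have cip: "cip (cfgs d (U \<union> V)) (E (j, k)) (E (j', k')) = cip (cfgs d U) (e j) (e j') * cip (cfgs d V) (g k) (g k')" for j k j' k'
    unfolding cip_def sum_cfgs_Un[OF UV] sum_product by (intro sum.cong refl) (simp add: E mult_ac)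
  \<comment> \<open>With all coefficients 1, \<open>diag\<close> turns the resolution of the
    identity on the union into the product of the two given ones.\<close>
  have one: "(\<Sum>p\<in>J \<times> K. E p s * cnj (E p t)) = of_bool (s = t)" if s: "s \<in> cfgs d (U \<union> V)" and t: "t \<in> cfgs d (U \<union> V)" for s t
  proof -
    obtain u v where uv: "u \<in> cfgs d U" "v \<in> cfgs d V" "s = merge V v u" using cfgs_Un_cases[OF UV s] .
    obtain u' v' where uv': "u' \<in> cfgs d U" "v' \<in> cfgs d V" "t = merge V v' u'" using cfgs_Un_cases[OF UV t] .
    have "(\<Sum>p\<in>J \<times> K. E p s * cnj (E p t)) = diag_op (J \<times> K) (\<lambda>(j, k). 1 * 1) E (merge V v u) (merge V v' u')"
      by (simp add: diag_op_def uv uv' case_prod_unfold)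
    also have "\<dots> = of_bool (u = u') * of_bool (v = v')"
      using uv uv' by (subst diag) (simp_all add: diag_op_one[OF e] diag_op_one[OF g])
    also have "\<dots> = of_bool (s = t)" using uv uv' by (simp add: merge_eq_iff[OF UV, where d = d])
    finally show ?thesis .
  qed
  show "orthonormal_basis (cfgs d (U \<union> V)) (J \<times> K) E"
    using e g fin one by (auto simp: orthonormal_basis_def cip)
qed

text \<open>In the product eigenbasis the energies are \<open>a j + b k - c\<close>, so Boltzmann
  weights and partition functions both multiply.\<close>

lemma gibbs_product:
  assumes f: "finite U" "finite V" and UV: "U \<inter> V = {}"
    and hU: "hermitian d U (ham d h U)" and hV: "hermitian d V (ham d h V)"
    and H: "\<And>u u' v v'. u \<in> cfgs d U \<Longrightarrow> u' \<in> cfgs d U \<Longrightarrow> v \<in> cfgs d V \<Longrightarrow> v' \<in> cfgs d V \<Longrightarrow>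
      ham d h (U \<union> V) (merge V v u) (merge V v' u') =
        of_bool (v = v') * ham d h U u u' + of_bool (u = u') * ham d h V v v' - of_real c * of_bool (u = u') * of_bool (v = v')"
    and uv: "u \<in> cfgs d U" "u' \<in> cfgs d U" "v \<in> cfgs d V" "v' \<in> cfgs d V"
  shows "gibbs d h \<beta> (U \<union> V) (merge V v u) (merge V v' u') = gibbs d h \<beta> U u u' * gibbs d h \<beta> V v v'"
proof -
  obtain n :: nat and a :: "nat \<Rightarrow> real" and e where e: "orthonormal_basis (cfgs d U) {..<n} e"
    and Ud: "\<And>s t. s \<in> cfgs d U \<Longrightarrow> t \<in> cfgs d U \<Longrightarrow> ham d h U s t = diag_op {..<n} (\<lambda>k. of_real (a k)) e s t"
    using spectral_theorem[OF finite_cfgs[OF f(1)]] hU unfolding hermitian_iff by metis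
  obtain m :: nat and b :: "nat \<Rightarrow> real" and g where g: "orthonormal_basis (cfgs d V) {..<m} g"
    and Vd: "\<And>s t. s \<in> cfgs d V \<Longrightarrow> t \<in> cfgs d V \<Longrightarrow> ham d h V s t = diag_op {..<m} (\<lambda>k. of_real (b k)) g s t"
    using spectral_theorem[OF finite_cfgs[OF f(2)]] hV unfolding hermitian_iff by metis
  let ?K = "{..<n} \<times> {..<m}"
  define E where "E = (\<lambda>(j, k) s. e j (restrict s U) * g k (restrict s V))"
  have E: "\<forall>j k. \<forall>u\<in>cfgs d U. \<forall>v\<in>cfgs d V. E (j, k) (merge V v u) = e j u * g k v"
    using UV by (simp add: E_def restrict_merge_left restrict_merge_right restrict_cfgs_id)
  have fin: "finite (cfgs d (U \<union> V))" using f by (simp add: finite_cfgs)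
  note onb = orthonormal_basis_tensor(1)[OF UV e g fin E]
  note tens = orthonormal_basis_tensor(2)[OF UV e g fin E]
  have HE: "ham d h (U \<union> V) s t = diag_op ?K (\<lambda>p. of_real (case p of (j, k) \<Rightarrow> a j + b k - c)) E s t"
    if s: "s \<in> cfgs d (U \<union> V)" and t: "t \<in> cfgs d (U \<union> V)" for s t
  proof -
    obtain u v where uv: "u \<in> cfgs d U" "v \<in> cfgs d V" "s = merge V v u" using cfgs_Un_cases[OF UV s] .
    obtain u' v' where uv': "u' \<in> cfgs d U" "v' \<in> cfgs d V" "t = merge V v' u'" using cfgs_Un_cases[OF UV t] .
    note tens' = tens[OF uv(1) uv'(1) uv(2) uv'(2)]
    have "diag_op ?K (\<lambda>p. of_real (case p of (j, k) \<Rightarrow> a j + b k - c)) E s t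
        = diag_op ?K (\<lambda>(j, k). of_real (a j) * 1) E s t + diag_op ?K (\<lambda>(j, k). 1 * of_real (b k)) E s t
          - of_real c * diag_op ?K (\<lambda>(j, k). 1 * 1) E s t"
      unfolding diag_op_def sum_distrib_left sum.distrib[symmetric] sum_subtractf[symmetric]
      by (intro sum.cong refl) (auto simp: algebra_simps)
    also have "\<dots> = ham d h (U \<union> V) s t"
      unfolding uv(3) uv'(3) tens' H[OF uv(1) uv'(1) uv(2) uv'(2)]
      using uv uv' by (simp add: Ud Vd diag_op_one[OF e] diag_op_one[OF g])
    finally show ?thesis by simp
  qed
  let ?ZU = "\<Sum>j<n. exp (- \<beta> * a j)" and ?ZV = "\<Sum>k<m. exp (- \<beta> * b k)"
  \<comment> \<open>The shift by \<open>c\<close> contributes the same factor to every weight and to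
    the partition function \<open>Z\<close>, so it drops out of the quotient.\<close>
  have w: "exp (- \<beta> * (case p of (j, k) \<Rightarrow> a j + b k - c))
      = exp (\<beta> * c) * (case p of (j, k) \<Rightarrow> exp (- \<beta> * a j) * exp (- \<beta> * b k))" for p
    by (auto simp: algebra_simps split: prod.splits simp flip: exp_add)
  have Z: "(\<Sum>p\<in>?K. exp (- \<beta> * (case p of (j, k) \<Rightarrow> a j + b k - c))) = exp (\<beta> * c) * (?ZU * ?ZV)"
    unfolding w sum_product sum.cartesian_product by (rule sum_distrib_left[symmetric])
  have "gibbs d h \<beta> (U \<union> V) (merge V v u) (merge V v' u')
      = diag_op ?K (\<lambda>p. complex_of_real (exp (- \<beta> * (case p of (j, k) \<Rightarrow> a j + b k - c)) /
          (\<Sum>p\<in>?K. exp (- \<beta> * (case p of (j, k) \<Rightarrow> a j + b k - c))))) E (merge V v u) (merge V v' u')"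
    by (rule gibbs_diag_op[OF onb HE]) (use uv merge_in_cfgs[OF UV] in auto)
  also have "\<dots> = diag_op ?K (\<lambda>(j, k). of_real (exp (- \<beta> * a j) / ?ZU) * of_real (exp (- \<beta> * b k) / ?ZV)) E (merge V v u) (merge V v' u')"
    unfolding Z unfolding w diag_op_def by (intro sum.cong refl) auto
  also have "\<dots> = gibbs d h \<beta> U u u' * gibbs d h \<beta> V v v'"
    using uv by (simp only: tens gibbs_diag_op[OF e Ud] gibbs_diag_op[OF g Vd])
  finally show ?thesis .
qed

text \<open>The constant term of the empty region occurs in both local Hamiltonians; it cancels in the
  normalised Gibbs states.\<close>

lemma ham_product:
  assumes f: "finite U" "finite V" and UV: "U \<inter> V = {}" and h0: "hermitian d {} (h {})"
    and cross: "\<And>Z s t. Z \<subseteq> U \<union> V \<Longrightarrow> \<not> Z \<subseteq> U \<Longrightarrow> \<not> Z \<subseteq> V \<Longrightarrow> s \<in> cfgs d Z \<Longrightarrow> t \<in> cfgs d Z \<Longrightarrow> h Z s t = 0"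
    and uv: "u \<in> cfgs d U" "u' \<in> cfgs d U" "v \<in> cfgs d V" "v' \<in> cfgs d V"
  shows "ham d h (U \<union> V) (merge V v u) (merge V v' u') =
      of_bool (v = v') * ham d h U u u' + of_bool (u = u') * ham d h V v v'
      - of_real (Re (h {} (\<lambda>_. undefined) (\<lambda>_. undefined))) * of_bool (u = u') * of_bool (v = v')"
proof -
  let ?s = "merge V v u" and ?t = "merge V v' u'"
  let ?T = "\<lambda>Z. ext_op Z (U \<union> V) (h Z) ?s ?t"
  have st: "?s \<in> cfgs d (U \<union> V)" "?t \<in> cfgs d (U \<union> V)" using uv merge_in_cfgs[OF UV] by auto
  have "ham d h (U \<union> V) ?s ?t = sum ?T (Pow U \<union> Pow V)"
    unfolding ham_def
  proof (rule sum.mono_neutral_right)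
    show "\<forall>Z\<in>Pow (U \<union> V) - (Pow U \<union> Pow V). ?T Z = 0"
      using cross restrict_cfgs[OF st(1)] restrict_cfgs[OF st(2)] by (auto simp: ext_op_def)
  qed (use f in auto)
  \<comment> \<open>Inclusion-exclusion: the subsets of \<open>U\<close> and those of
    \<open>V\<close> share only the empty set, whose term is counted twice.\<close>
  also have "\<dots> = sum ?T (Pow U) + sum ?T (Pow V) - sum ?T (Pow U \<inter> Pow V)"
    using f by (intro sum_Un) auto
  also have "Pow U \<inter> Pow V = {{}}" using UV by blast
  also have "sum ?T (Pow U) = of_bool (v = v') * ham d h U u u'"
    unfolding ham_def sum_distrib_left
    by (intro sum.cong refl) (simp add: ext_op_merge_left[OF UV, where d = d] uv)
  also have "sum ?T (Pow V) = of_bool (u = u') * ham d h V v v'"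
    unfolding ham_def sum_distrib_left
    by (intro sum.cong refl) (simp add: ext_op_merge_right[OF UV, where d = d] uv)
  also have "sum ?T {{}} = of_real (Re (h {} (\<lambda>_. undefined) (\<lambda>_. undefined))) * of_bool (u = u') * of_bool (v = v')"
  proof -
    \<comment> \<open>The empty region has a single configuration, so its term is a scalar, and it
      is real because it is Hermitian.\<close>
    have "(\<lambda>_. undefined) \<in> cfgs d {}" by (simp add: cfgs_def)
    then have "h {} (\<lambda>_. undefined) (\<lambda>_. undefined) = cnj (h {} (\<lambda>_. undefined) (\<lambda>_. undefined))"
      using h0 unfolding hermitian_def by blast
    from arg_cong[OF this, of Im] have "of_real (Re (h {} (\<lambda>_. undefined) (\<lambda>_. undefined))) = h {} (\<lambda>_. undefined) (\<lambda>_. undefined)"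
      by (simp add: complex_eq_iff)
    moreover have "sum ?T {{}} = of_bool (v = v') * ext_op {} U (h {}) u u'"
      by (simp add: ext_op_merge_left[OF UV, where d = d] uv)
    ultimately show ?thesis
      using uv by (simp add: ext_op_def restrict_cfgs_id restrict_def[of _ "{}"])
  qed
  finally show ?thesis .
qed

text \<open>A path in \<open>Z\<close> from a point outside \<open>V\<close> to a point outside
  \<open>U\<close> must step from \<open>U\<close> into \<open>V\<close>; otherwise induction along
  it would keep it in \<open>U\<close>.\<close>

lemma lconnected_crossing:
  assumes "lconnected Z" "Z \<subseteq> U \<union> V" "\<not> Z \<subseteq> U" "\<not> Z \<subseteq> V"
  obtains x y where "x \<in> U \<inter> Z" "y \<in> V \<inter> Z" "ldist x y = 1"
proof -
  obtain x y where xy: "x \<in> Z" "x \<notin> V" "y \<in> Z" "y \<notin> U" using assms by blast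
  then obtain p where p: "is_path Z p" "hd p = x" "last p = y"
    using assms(1) unfolding lconnected_def by blast
  have pne: "p \<noteq> []" and pZ: "set p \<subseteq> Z" and adj: "\<And>i. Suc i < length p \<Longrightarrow> ldist (p ! i) (p ! Suc i) = 1"
    using p(1) by (auto simp: is_path_def)
  have "\<exists>i. Suc i < length p \<and> p ! i \<in> U \<and> p ! Suc i \<in> V"
  proof (rule ccontr)
    assume no: "\<nexists>i. Suc i < length p \<and> p ! i \<in> U \<and> p ! Suc i \<in> V"
    have "p ! i \<in> U" if "i < length p" for i
      using that
    proof (induction i)
      case 0
      then show ?case using p(2) xy assms(2) pne by (auto simp: hd_conv_nth)
    next
      case (Suc i)
      then have "p ! Suc i \<in> Z" using pZ nth_mem by blast
      then show ?case using Suc no assms(2) by (meson Suc_lessD UnE subsetD)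
    qed
    then show False using p(3) xy pne by (auto simp: last_conv_nth)
  qed
  then obtain i where i: "Suc i < length p" "p ! i \<in> U" "p ! Suc i \<in> V" by blast
  moreover have "p ! i \<in> Z" "p ! Suc i \<in> Z" using i(1) nth_mem[of i p] nth_mem[of "Suc i" p] pZ by auto
  ultimately show thesis using that adj by blast
qed

text \<open>A crossing set contains neighbours \<open>x\<close> in \<open>A \<union> B\<close> and
  \<open>y\<close> in \<open>C - bdry B C\<close>. If \<open>x\<close> were in \<open>B\<close>,
  then \<open>y\<close> would be a boundary site; if \<open>x\<close> is in \<open>A\<close>, the
  two-site path from \<open>x\<close> to \<open>y\<close> avoids \<open>B\<close>.\<close>

lemma shielded_no_crossing:
  assumes sh: "shields (A \<union> B \<union> C) A B C l" and disj: "A \<inter> B = {}" "B \<inter> C = {}"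
    and Z: "lconnected Z" "Z \<subseteq> (A \<union> B) \<union> (C - bdry B C)"
  shows "Z \<subseteq> A \<union> B \<or> Z \<subseteq> C - bdry B C"
proof (rule ccontr)
  assume "\<not> ?thesis"
  then obtain x y where xy: "x \<in> A \<union> B" "y \<in> C" "y \<notin> bdry B C" "ldist x y = 1"
    using lconnected_crossing[OF Z] by blast
  then have x: "x \<in> A" by (auto simp: bdry_def)
  have "is_path (A \<union> B \<union> C) [x, y]" using xy by (auto simp: is_path_def)
  then have "set [x, y] \<inter> B \<noteq> {}" using sh x xy unfolding shields_def by fastforce
  then show False using x xy disj by auto
qed

section \<open>Telescoping over the boundary and decoupling the remainder\<close>

theorem theorem1:
  fixes dmax r :: nat and J \<beta> c1 c2 M :: real
  assumes "0 < \<beta>" and "0 < c1" and "0 < c2"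
  shows "\<exists>K::real. \<forall>(\<Lambda>::('d::finite) site set) d h \<epsilon>.
     finite \<Lambda> \<and> (\<forall>x. 1 \<le> d x \<and> d x \<le> dmax) \<and> local_bounded_ham d h r J
     \<and> uniformly_clustering d h \<beta> \<Lambda> \<epsilon> \<and> bp_error d h \<beta> \<Lambda> c1 c2 M \<longrightarrow>
     (\<forall>X A B C l. X \<subseteq> \<Lambda> \<and> X = A \<union> B \<union> C \<and> A \<inter> B = {} \<and> A \<inter> C = {} \<and> B \<inter> C = {}
        \<and> 0 < l \<and> shields X A B C l \<longrightarrow>
        tnorm d A (msub (ptr d (B \<union> C) (gibbs d h \<beta> X)) (ptr d B (gibbs d h \<beta> (A \<union> B))))
          \<le> K * real (card (bdry B C)) * (\<epsilon> (l / 2) + c1 * exp (- c2 * (l / 2))))"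
proof (intro exI[of _ "\<bar>M\<bar> + 2"] allI impI, elim conjE)
  fix \<Lambda> :: "'d site set" and d h \<epsilon> X A B C l
  assume \<Lambda>: "finite \<Lambda>" and d: "\<forall>x. 1 \<le> d x \<and> d x \<le> dmax" and lb: "local_bounded_ham d h r J"
    and cl: "uniformly_clustering d h \<beta> \<Lambda> \<epsilon>" and bp: "bp_error d h \<beta> \<Lambda> c1 c2 M"
    and X: "X \<subseteq> \<Lambda>" "X = A \<union> B \<union> C" and disj: "A \<inter> B = {}" "A \<inter> C = {}" "B \<inter> C = {}"
    and l: "0 < l" and sh: "shields X A B C l"
  let ?\<gamma> = "c1 * exp (- c2 * (l / 2))"
  define \<kappa> where "\<kappa> = \<bar>M\<bar> * \<epsilon> (l / 2) + 2 * ?\<gamma>"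
  define D where "D = bdry B C"
  have DC: "D \<subseteq> C" by (auto simp: D_def bdry_def)
  have fX: "finite X" using \<Lambda> X(1) by (rule rev_finite_subset)
  then have fin: "finite A" "finite B" "finite C" "finite D"
    using X(2) finite_subset[OF DC] by auto
  have d1: "1 \<le> d x" for x using d by simp
  have h: "hermitian d Z (h Z)" if "finite Z" for Z using lb that by (simp add: local_bounded_ham_def)
  have hH: "hermitian d Z (ham d h Z)" if "finite Z" for Z
    using h that by (meson hermitian_ham finite_subset)
  note gs = gibbs_state[OF finite_cfgs cfgs_nonempty[of d, OF d1] hH]
  let ?N = "msub (ptr d (B \<union> C) (gibbs d h \<beta> X)) (ptr d B (gibbs d h \<beta> (A \<union> B)))"
  have "hermitian d A ?N"
    using gs(1)[where Y = X and \<beta> = \<beta>] gs(1)[where Y = "A \<union> B" and \<beta> = \<beta>] fin fX disj unfolding X(2)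
    by (intro hermitian_msub hermitian_ptr) (auto simp: Un_assoc)
  then obtain F where F: "hermitian d A F" "contraction (cfgs d A) F"
    and tn: "tnorm d A ?N = Re (mtr d A (mmult d A F ?N))"
    using tnorm_attained[OF finite_cfgs[OF fin(1)]] by metis
  \<comment> \<open>\<open>T\<close> interpolates between the two states: its values at
    \<open>X\<close> and \<open>A \<union> B\<close> are the expectations of \<open>F\<close> in the
    two reduced states.\<close>
  define T where "T Y = mtr d Y (mmult d Y (ext_op A Y F) (gibbs d h \<beta> Y))" for Y
  have TX: "T X = mtr d A (mmult d A F (ptr d (B \<union> C) (gibbs d h \<beta> X)))"
    using mtr_ext_op_ptr[of A "B \<union> C" d F] disj fin unfolding T_def X(2) by (simp add: Un_assoc Int_Un_distrib)
  have TAB: "T (A \<union> B) = mtr d A (mmult d A F (ptr d B (gibbs d h \<beta> (A \<union> B))))"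
    using mtr_ext_op_ptr[of A B d F] disj fin unfolding T_def by simp
  \<comment> \<open>Every removed site lies in \<open>C\<close>, hence at distance at least
    \<open>l\<close> from \<open>A\<close>. Clustering and belief propagation hold on all subregions
    of \<Lambda>, so each removal costs the same \<kappa>.\<close>
  have tele: "cmod (T X - T (X - S)) \<le> real (card S) * \<kappa>" if "finite S" "S \<subseteq> D" for S
    using that
  proof (induction S rule: finite_induct)
    case (insert y S)
    have y: "y \<in> C" using insert.prems DC by auto
    have "cmod (T (X - S) - T (X - S - {y})) \<le> \<kappa>"
      unfolding T_def \<kappa>_def
    proof (rule site_removal[OF \<Lambda> _ _ _ d1 h cl bp l _ F])
      show "A \<subseteq> X - S" using insert.prems DC disj X(2) by auto
      show "l \<le> ldist a y" if "a \<in> A" for a using sh that y by (simp add: shields_def)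
    qed (use X insert.hyps y in auto)
    moreover have "X - insert y S = X - S - {y}" by auto
    moreover have "cmod (T X - T (X - S)) \<le> real (card S) * \<kappa>" using insert by auto
    ultimately show ?case
      using norm_triangle_ineq[of "T X - T (X - S)" "T (X - S) - T (X - S - {y})"] insert.hyps
      by (simp add: algebra_simps)
  qed simp
  \<comment> \<open>Without \<open>D\<close> every nonzero interaction term lies on one side, so the
    Gibbs state is a product whose factor on \<open>V\<close> has trace 1.\<close>
  have split: "T (X - D) = T (A \<union> B)"
  proof -
    define V where "V = C - D"
    have XD: "X - D = (A \<union> B) \<union> V" using X(2) DC disj by (auto simp: V_def)
    have UV: "(A \<union> B) \<inter> V = {}" using disj by (auto simp: V_def)
    have fU: "finite (A \<union> B)" "finite V" using fin by (auto simp: V_def)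
    have cross: "h Z s t = 0" if "Z \<subseteq> (A \<union> B) \<union> V" "\<not> Z \<subseteq> A \<union> B" "\<not> Z \<subseteq> V" "s \<in> cfgs d Z" "t \<in> cfgs d Z" for Z s t
    proof (rule ccontr)
      assume "h Z s t \<noteq> 0"
      moreover have "finite Z" using that(1) fU by (meson finite_UnI finite_subset)
      ultimately have "lconnected Z" using lb that unfolding local_bounded_ham_def by blast
      then show False using shielded_no_crossing[OF _ disj(1,3), of l Z] sh X(2) that
        unfolding V_def D_def by blast
    qed
    have "T (X - D) = T (A \<union> B) * mtr d V (gibbs d h \<beta> V)"
      unfolding T_def XD
    proof (rule mtr_ext_op_product[OF UV _ fU(2)])
      fix u u' v v' assume uv: "u \<in> cfgs d (A \<union> B)" "u' \<in> cfgs d (A \<union> B)" "v \<in> cfgs d V" "v' \<in> cfgs d V"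
      show "gibbs d h \<beta> (A \<union> B \<union> V) (merge V v u) (merge V v' u') = gibbs d h \<beta> (A \<union> B) u u' * gibbs d h \<beta> V v v'"
        by (rule gibbs_product[OF fU UV hH[OF fU(1)] hH[OF fU(2)] _ uv], rule ham_product[where d = d and h = h, OF fU UV h[OF finite.emptyI]])
          (rule cross | assumption)+
    qed blast
    also have "mtr d V (gibbs d h \<beta> V) = 1" using fU by (intro gs(2))
    finally show ?thesis by simp
  qed
  have "tnorm d A ?N = Re (T X - T (A \<union> B))" by (simp add: tn mtr_mmult_msub TX TAB)
  also have "\<dots> \<le> cmod (T X - T (X - D))" unfolding split by (rule complex_Re_le_cmod)
  also have "\<dots> \<le> real (card D) * \<kappa>" using tele fin by simp
  \<comment> \<open>This fixes the constant: the clustering and belief propagation errors are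
    nonnegative, so raising both their coefficients in \<kappa> to \<open>\<bar>M\<bar> + 2\<close>
    only enlarges the bound.\<close>
  also have "\<dots> \<le> real (card D) * ((\<bar>M\<bar> + 2) * (\<epsilon> (l / 2) + ?\<gamma>))"
    using uniformly_clustering_nonneg[OF cl, of "l / 2"] assms
    by (intro mult_left_mono) (simp_all add: \<kappa>_def algebra_simps)
  finally show "tnorm d A ?N \<le> (\<bar>M\<bar> + 2) * real (card (bdry B C)) * (\<epsilon> (l / 2) + ?\<gamma>)"
    by (simp add: D_def mult_ac)
qed

end
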